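(* Let $(A,X,\psi)$ be a cowreath in a strict monoidal category $\mathcal C$. If $\underline 1$ is a left $\otimes$-generator for $\mathcal C$, then the forgetful functor $F:\mathcal C(\psi)_A^X\to\mathcal C_A$ is Frobenius if and only if $(X,\psi)$ is a Frobenius coalgebra in $\mathcal T_A^\#$.
   Context: Conventions: $\mathcal C$ is a strict monoidal category with unit object $\underline 1$; the tensor product is written by juxtaposition, and the identity morphism of $X$ is written $X$ (so $fA=f\otimes \mathrm{Id}_A$). $(A,m,\eta)$ is an algebra in $\mathcal C$; $\mathcal C_A$ is the category of right $A$-modules $(N,\mu:NA\to N)$. Frobenius functor: a functor having a right adjoint which is also a left adjoint of it. Left $\otimes$-generator: $P\in\mathcal C$ is a left $\otimes$-generator if for all $f,g:YZ\to W$ in $\mathcal C$: if $f\circ hZ=g\circ hZ$ for all $h:P\to Y$, then $f=g$. Transfer morphisms: $\mathcal T_A^\#$ has as objects the pairs $(X,\psi)$, $\psi:XA\to AX$ with $\psi\circ Xm=mX\circ A\psi\circ\psi A$ and $\psi\circ X\eta=\eta X$. A morphism $(X,\psi_X)\to(Y,\psi_Y)$ is $f:X\to AY$ in $\mathcal C$ with $mY\circ Af\circ\psi_X=mY\circ A\psi_Y\circ fA$; composition $g\bullet f=mZ\circ Ag\circ f$, identity $\eta X$; tensor product of objects $(XY,\psi_XY\circ X\psi_Y)$, of morphisms $f:X\to AX'$, $g:Y\to AY'$: $mX'Y'\circ A\psi_{X'}Y'\circ fg$; unit object $(\underline 1,A)$. Cowreath: $(A,X,\psi)$ with $(X,\psi)$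 a coalgebra in $\mathcal T_A^\#$; explicitly there are $\delta:X\to AXX$, $\epsilon:X\to A$ with $mXX\circ A\psi X\circ AX\psi\circ\delta A=mXX\circ A\delta\circ\psi$; $mXXX\circ A\delta X\circ\delta=mXXX\circ A\psi XX\circ AX\delta\circ\delta$; $m\circ A\epsilon\circ\psi=m\circ\epsilon A$; $mX\circ A\epsilon X\circ\delta=\eta X=mX\circ A\psi\circ AX\epsilon\circ\delta$. Entwined modules: objects of $\mathcal C(\psi)_A^X$ are $(M,\mu,\rho)$ with $(M,\mu)\in\mathcal C_A$, $\rho:M\to MX$, $\rho\circ\mu=\mu X\circ M\psi\circ\rho A$, $\rho X\circ\rho=\mu XX\circ M\delta\circ\rho$, $\mu\circ M\epsilon\circ\rho=M$. Morphisms are right $A$-linear $f$ with $fX\circ\rho=\rho\circ f$. Frobenius coalgebra: a coalgebra $(C,\Delta,\varepsilon)$ in a strict monoidal category is Frobenius if there are morphisms $t:\underline 1\to C$, $B:CC\to\underline 1$ with $CB\circ\Delta C=BC\circ C\Delta$ and $B\circ tC=\varepsilon=B\circ Ct$. For $(X,\psi)$ in $\mathcal T_A^\#$ this means: there are $t:\underline 1\to AX$, $B:XX\to A$ in $\mathcal C$ with $mX\circ At=mX\circ A\psi\circ tA$; $m\circ BA=m\circ AB\circ\psi X\circ X\psi$; $mX\circ A\psi\circ AXB\circ\delta X=mX\circ ABX\circ\psi XX\circ X\delta$; $m\circ AB\circ tX=\epsilon=m\circ AB\circ\psi X\circ Xt$. *)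

theory Defs
  imports Main
begin

section \<open>Categories, functors and Frobenius functors\<close>

record ('o, 'm) category =
  Ob :: "'o set"
  Ar :: "'m set"
  Dom :: "'m \<Rightarrow> 'o"
  Cod :: "'m \<Rightarrow> 'o"
  Id :: "'o \<Rightarrow> 'm"
  Comp :: "'m \<Rightarrow> 'm \<Rightarrow> 'm" (infixr "\<cdot>\<index>" 60)

definition hom :: "('o, 'm, 'z) category_scheme \<Rightarrow> 'o \<Rightarrow> 'o \<Rightarrow> 'm set" where
  "hom C X Y = {f \<in> Ar C. Dom C f = X \<and> Cod C f = Y}"

locale category =
  fixes C :: "('o, 'm, 'z) category_scheme" (structure)
  assumes dom_in_Ob: "f \<in> Ar C \<Longrightarrow> Dom C f \<in> Ob C"
    and cod_in_Ob: "f \<in> Ar C \<Longrightarrow> Cod C f \<in> Ob C"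
    and id_in_hom: "X \<in> Ob C \<Longrightarrow> Id C X \<in> hom C X X"
    and comp_in_hom: "f \<in> hom C X Y \<Longrightarrow> g \<in> hom C Y Z \<Longrightarrow> g \<cdot> f \<in> hom C X Z"
    and comp_assoc: "f \<in> hom C W X \<Longrightarrow> g \<in> hom C X Y \<Longrightarrow> h \<in> hom C Y Z \<Longrightarrow>
          (h \<cdot> g) \<cdot> f = h \<cdot> (g \<cdot> f)"
    and comp_id_right: "f \<in> hom C X Y \<Longrightarrow> f \<cdot> Id C X = f"
    and comp_id_left: "f \<in> hom C X Y \<Longrightarrow> Id C Y \<cdot> f = f"

text \<open>A functor is given by its object map and its arrow map; their values outside
  the objects and arrows of the source category are irrelevant.\<close>

locale category_functor = C: category C + D: category D
  for C :: "('o1, 'm1, 'z1) category_scheme"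
    and D :: "('o2, 'm2, 'z2) category_scheme" +
  fixes Fo :: "'o1 \<Rightarrow> 'o2" and Fa :: "'m1 \<Rightarrow> 'm2"
  assumes ob_map: "X \<in> Ob C \<Longrightarrow> Fo X \<in> Ob D"
    and ar_map: "f \<in> hom C X Y \<Longrightarrow> Fa f \<in> hom D (Fo X) (Fo Y)"
    and map_id: "X \<in> Ob C \<Longrightarrow> Fa (Id C X) = Id D (Fo X)"
    and map_comp: "f \<in> hom C X Y \<Longrightarrow> g \<in> hom C Y Z \<Longrightarrow>
          Fa (g \<cdot>\<^bsub>C\<^esub> f) = Fa g \<cdot>\<^bsub>D\<^esub> Fa f"

definition natural_transformation ::
  "('o1, 'm1, 'z1) category_scheme \<Rightarrow> ('o2, 'm2, 'z2) category_scheme \<Rightarrow>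
   ('o1 \<Rightarrow> 'o2) \<Rightarrow> ('m1 \<Rightarrow> 'm2) \<Rightarrow> ('o1 \<Rightarrow> 'o2) \<Rightarrow> ('m1 \<Rightarrow> 'm2) \<Rightarrow> ('o1 \<Rightarrow> 'm2) \<Rightarrow> bool" where
  "natural_transformation C D Fo Fa Go Ga \<tau> \<longleftrightarrow>
     (\<forall>X \<in> Ob C. \<tau> X \<in> hom D (Fo X) (Go X)) \<and>
     (\<forall>X \<in> Ob C. \<forall>Y \<in> Ob C. \<forall>f \<in> hom C X Y. \<tau> Y \<cdot>\<^bsub>D\<^esub> Fa f = Ga f \<cdot>\<^bsub>D\<^esub> \<tau> X)"

text \<open>The functor \<open>F : C \<rightarrow> D\<close> is left adjoint to \<open>G : D \<rightarrow> C\<close>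
  (unit, counit and triangle identities).\<close>

definition left_adjoint ::
  "('o1, 'm1, 'z1) category_scheme \<Rightarrow> ('o2, 'm2, 'z2) category_scheme \<Rightarrow>
   ('o1 \<Rightarrow> 'o2) \<Rightarrow> ('m1 \<Rightarrow> 'm2) \<Rightarrow> ('o2 \<Rightarrow> 'o1) \<Rightarrow> ('m2 \<Rightarrow> 'm1) \<Rightarrow> bool" where
  "left_adjoint C D Fo Fa Go Ga \<longleftrightarrow>
     category_functor C D Fo Fa \<and> category_functor D C Go Ga \<and>
     (\<exists>u c.
        natural_transformation C C (\<lambda>X. X) (\<lambda>f. f) (\<lambda>X. Go (Fo X)) (\<lambda>f. Ga (Fa f)) u \<and>
        natural_transformation D D (\<lambda>Y. Fo (Go Y)) (\<lambda>f. Fa (Ga f)) (\<lambda>Y. Y) (\<lambda>f. f) c \<and>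
        (\<forall>X \<in> Ob C. c (Fo X) \<cdot>\<^bsub>D\<^esub> Fa (u X) = Id D (Fo X)) \<and>
        (\<forall>Y \<in> Ob D. Ga (c Y) \<cdot>\<^bsub>C\<^esub> u (Go Y) = Id C (Go Y)))"

definition frobenius_functor ::
  "('o1, 'm1, 'z1) category_scheme \<Rightarrow> ('o2, 'm2, 'z2) category_scheme \<Rightarrow>
   ('o1 \<Rightarrow> 'o2) \<Rightarrow> ('m1 \<Rightarrow> 'm2) \<Rightarrow> bool" where
  "frobenius_functor C D Fo Fa \<longleftrightarrow>
     category_functor C D Fo Fa \<and>
     (\<exists>Go Ga. left_adjoint C D Fo Fa Go Ga \<and> left_adjoint D C Go Ga Fo Fa)"


section \<open>Strict monoidal categories\<close>

record ('o, 'm) monoidal_category = "('o, 'm) category" +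
  Unit :: "'o" ("\<one>\<index>")
  TensorOb :: "'o \<Rightarrow> 'o \<Rightarrow> 'o" (infixr "\<odot>\<index>" 75)
  TensorAr :: "'m \<Rightarrow> 'm \<Rightarrow> 'm" (infixr "\<otimes>\<index>" 70)

locale strict_monoidal_category = category C
  for C :: "('o, 'm, 'z) monoidal_category_scheme" (structure) +
  assumes unit_in_Ob: "\<one> \<in> Ob C"
    and tensor_in_Ob: "X \<in> Ob C \<Longrightarrow> Y \<in> Ob C \<Longrightarrow> X \<odot> Y \<in> Ob C"
    and tensor_in_hom: "f \<in> hom C X X' \<Longrightarrow> g \<in> hom C Y Y' \<Longrightarrow> f \<otimes> g \<in> hom C (X \<odot> Y) (X' \<odot> Y')"
    and tensor_id: "X \<in> Ob C \<Longrightarrow> Y \<in> Ob C \<Longrightarrow> Id C X \<otimes> Id C Y = Id C (X \<odot> Y)"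
    and interchange: "f \<in> hom C X X' \<Longrightarrow> f' \<in> hom C X' X'' \<Longrightarrow>
          g \<in> hom C Y Y' \<Longrightarrow> g' \<in> hom C Y' Y'' \<Longrightarrow>
          (f' \<cdot> f) \<otimes> (g' \<cdot> g) = (f' \<otimes> g') \<cdot> (f \<otimes> g)"
    and tensor_assoc_Ob: "X \<in> Ob C \<Longrightarrow> Y \<in> Ob C \<Longrightarrow> Z \<in> Ob C \<Longrightarrow>
          (X \<odot> Y) \<odot> Z = X \<odot> (Y \<odot> Z)"
    and tensor_assoc_Ar: "f \<in> Ar C \<Longrightarrow> g \<in> Ar C \<Longrightarrow> h \<in> Ar C \<Longrightarrow>
          (f \<otimes> g) \<otimes> h = f \<otimes> (g \<otimes> h)"
    and unit_left_Ob: "X \<in> Ob C \<Longrightarrow> \<one> \<odot> X = X"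
    and unit_right_Ob: "X \<in> Ob C \<Longrightarrow> X \<odot> \<one> = X"
    and unit_left_Ar: "f \<in> Ar C \<Longrightarrow> Id C \<one> \<otimes> f = f"
    and unit_right_Ar: "f \<in> Ar C \<Longrightarrow> f \<otimes> Id C \<one> = f"

text \<open>Whiskering: \<open>X \<rhd> f\<close> and \<open>f \<lhd> X\<close> are what is usually
  written \<open>Xf\<close> and \<open>fX\<close>.\<close>

definition whisker_left :: "('o, 'm, 'z) monoidal_category_scheme \<Rightarrow> 'o \<Rightarrow> 'm \<Rightarrow> 'm"
    (infixr "\<rhd>\<index>" 73) where
  "X \<rhd>\<^bsub>C\<^esub> f = Id C X \<otimes>\<^bsub>C\<^esub> f"

definition whisker_right :: "('o, 'm, 'z) monoidal_category_scheme \<Rightarrow> 'm \<Rightarrow> 'o \<Rightarrow> 'm"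
    (infixl "\<lhd>\<index>" 72) where
  "f \<lhd>\<^bsub>C\<^esub> X = f \<otimes>\<^bsub>C\<^esub> Id C X"

context
  fixes C :: "('o, 'm, 'z) monoidal_category_scheme" (structure)
begin

definition left_tensor_generator :: "'o \<Rightarrow> bool" where
  "left_tensor_generator P \<longleftrightarrow> P \<in> Ob C \<and>
     (\<forall>Y \<in> Ob C. \<forall>Z \<in> Ob C. \<forall>W \<in> Ob C.
        \<forall>f \<in> hom C (Y \<odot> Z) W. \<forall>g \<in> hom C (Y \<odot> Z) W.
          (\<forall>h \<in> hom C P Y. f \<cdot> (h \<lhd> Z) = g \<cdot> (h \<lhd> Z)) \<longrightarrow> f = g)"

definition algebra :: "'o \<Rightarrow> 'm \<Rightarrow> 'm \<Rightarrow> bool" where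
  "algebra A m \<eta> \<longleftrightarrow>
     A \<in> Ob C \<and> m \<in> hom C (A \<odot> A) A \<and> \<eta> \<in> hom C \<one> A \<and>
     m \<cdot> (m \<lhd> A) = m \<cdot> (A \<rhd> m) \<and>
     m \<cdot> (\<eta> \<lhd> A) = Id C A \<and> m \<cdot> (A \<rhd> \<eta>) = Id C A"

definition coalgebra :: "'o \<Rightarrow> 'm \<Rightarrow> 'm \<Rightarrow> bool" where
  "coalgebra X \<Delta> \<epsilon> \<longleftrightarrow>
     X \<in> Ob C \<and> \<Delta> \<in> hom C X (X \<odot> X) \<and> \<epsilon> \<in> hom C X \<one> \<and>
     (\<Delta> \<lhd> X) \<cdot> \<Delta> = (X \<rhd> \<Delta>) \<cdot> \<Delta> \<and>
     (\<epsilon> \<lhd> X) \<cdot> \<Delta> = Id C X \<and> (X \<rhd> \<epsilon>) \<cdot> \<Delta> = Id C X"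

definition frobenius_coalgebra :: "'o \<Rightarrow> 'm \<Rightarrow> 'm \<Rightarrow> bool" where
  "frobenius_coalgebra X \<Delta> \<epsilon> \<longleftrightarrow> coalgebra X \<Delta> \<epsilon> \<and>
     (\<exists>t \<in> hom C \<one> X. \<exists>B \<in> hom C (X \<odot> X) \<one>.
        (X \<rhd> B) \<cdot> (\<Delta> \<lhd> X) = (B \<lhd> X) \<cdot> (X \<rhd> \<Delta>) \<and>
        B \<cdot> (t \<lhd> X) = \<epsilon> \<and> B \<cdot> (X \<rhd> t) = \<epsilon>)"

definition right_module :: "'o \<Rightarrow> 'm \<Rightarrow> 'm \<Rightarrow> 'o \<Rightarrow> 'm \<Rightarrow> bool" where
  "right_module A m \<eta> N \<mu> \<longleftrightarrow>
     N \<in> Ob C \<and> \<mu> \<in> hom C (N \<odot> A) N \<and>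
     \<mu> \<cdot> (\<mu> \<lhd> A) = \<mu> \<cdot> (N \<rhd> m) \<and> \<mu> \<cdot> (N \<rhd> \<eta>) = Id C N"

text \<open>In the categories built from \<open>C\<close> below, an arrow is a triple
  \<open>(source, target, f)\<close> with \<open>f\<close> an arrow of \<open>C\<close>, so that source and target
  are determined by the arrow.\<close>

definition right_modules :: "'o \<Rightarrow> 'm \<Rightarrow> 'm \<Rightarrow> ('o \<times> 'm, ('o \<times> 'm) \<times> ('o \<times> 'm) \<times> 'm) category" where
  "right_modules A m \<eta> =
     \<lparr> Ob = {(N, \<mu>). right_module A m \<eta> N \<mu>},
       Ar = {((N, \<mu>), (N', \<mu>'), f).
               right_module A m \<eta> N \<mu> \<and> right_module A m \<eta> N' \<mu>' \<and>
               f \<in> hom C N N' \<and> f \<cdot> \<mu> = \<mu>' \<cdot> (f \<lhd> A)},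
       Dom = (\<lambda>(x, y, f). x),
       Cod = (\<lambda>(x, y, f). y),
       Id = (\<lambda>(N, \<mu>). ((N, \<mu>), (N, \<mu>), Id C N)),
       Comp = (\<lambda>(y', z, g) (x, y, f). (x, z, g \<cdot> f)) \<rparr>"


section \<open>Transfer morphisms and cowreaths\<close>

definition transfer_object :: "'o \<Rightarrow> 'm \<Rightarrow> 'm \<Rightarrow> 'o \<Rightarrow> 'm \<Rightarrow> bool" where
  "transfer_object A m \<eta> X \<psi> \<longleftrightarrow>
     X \<in> Ob C \<and> \<psi> \<in> hom C (X \<odot> A) (A \<odot> X) \<and>
     \<psi> \<cdot> (X \<rhd> m) = (m \<lhd> X) \<cdot> (A \<rhd> \<psi>) \<cdot> (\<psi> \<lhd> A) \<and>
     \<psi> \<cdot> (X \<rhd> \<eta>) = \<eta> \<lhd> X"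

definition transfer_category ::
  "'o \<Rightarrow> 'm \<Rightarrow> 'm \<Rightarrow> ('o \<times> 'm, ('o \<times> 'm) \<times> ('o \<times> 'm) \<times> 'm) monoidal_category" where
  "transfer_category A m \<eta> =
     \<lparr> Ob = {(X, \<psi>). transfer_object A m \<eta> X \<psi>},
       Ar = {((X, \<psi>), (Y, \<phi>), f).
               transfer_object A m \<eta> X \<psi> \<and> transfer_object A m \<eta> Y \<phi> \<and>
               f \<in> hom C X (A \<odot> Y) \<and>
               (m \<lhd> Y) \<cdot> (A \<rhd> f) \<cdot> \<psi> = (m \<lhd> Y) \<cdot> (A \<rhd> \<phi>) \<cdot> (f \<lhd> A)},
       Dom = (\<lambda>(x, y, f). x),
       Cod = (\<lambda>(x, y, f). y),
       Id = (\<lambda>(X, \<psi>). ((X, \<psi>), (X, \<psi>), \<eta> \<lhd> X)),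
       Comp = (\<lambda>(y', (Z, \<zeta>), g) (x, y, f). (x, (Z, \<zeta>), (m \<lhd> Z) \<cdot> (A \<rhd> g) \<cdot> f)),
       Unit = (\<one>, Id C A),
       TensorOb = (\<lambda>(X, \<psi>) (Y, \<phi>). (X \<odot> Y, (\<psi> \<lhd> Y) \<cdot> (X \<rhd> \<phi>))),
       TensorAr = (\<lambda>((X, \<psi>), (X', \<psi>'), f) ((Y, \<phi>), (Y', \<phi>'), g).
          ((X \<odot> Y, (\<psi> \<lhd> Y) \<cdot> (X \<rhd> \<phi>)),
           (X' \<odot> Y', (\<psi>' \<lhd> Y') \<cdot> (X' \<rhd> \<phi>')),
           (m \<lhd> (X' \<odot> Y')) \<cdot> (A \<rhd> \<psi>' \<lhd> Y') \<cdot> (f \<otimes> g))) \<rparr>"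

end

text \<open>For \<open>\<delta> : X \<rightarrow> AXX\<close> and \<open>\<epsilon> : X \<rightarrow> A\<close> in \<open>C\<close>, the corresponding triples that serve as
  comultiplication and counit of \<open>(X, \<psi>)\<close> in the transfer category.\<close>

definition transfer_comult where
  "transfer_comult C A m \<eta> X \<psi> \<delta> =
     ((X, \<psi>), (X, \<psi>) \<odot>\<^bsub>transfer_category C A m \<eta>\<^esub> (X, \<psi>), \<delta>)"

definition transfer_counit where
  "transfer_counit C A m \<eta> X \<psi> \<epsilon> =
     ((X, \<psi>), \<one>\<^bsub>transfer_category C A m \<eta>\<^esub>, \<epsilon>)"

definition cowreath ::
  "('o, 'm, 'z) monoidal_category_scheme \<Rightarrow> 'o \<Rightarrow> 'm \<Rightarrow> 'm \<Rightarrow> 'o \<Rightarrow> 'm \<Rightarrow> 'm \<Rightarrow> 'm \<Rightarrow> bool" where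
  "cowreath C A m \<eta> X \<psi> \<delta> \<epsilon> \<longleftrightarrow>
     algebra C A m \<eta> \<and>
     coalgebra (transfer_category C A m \<eta>) (X, \<psi>)
       (transfer_comult C A m \<eta> X \<psi> \<delta>) (transfer_counit C A m \<eta> X \<psi> \<epsilon>)"


section \<open>Entwined modules\<close>

context
  fixes C :: "('o, 'm, 'z) monoidal_category_scheme" (structure)
begin

definition entwined_module ::
  "'o \<Rightarrow> 'm \<Rightarrow> 'm \<Rightarrow> 'o \<Rightarrow> 'm \<Rightarrow> 'm \<Rightarrow> 'm \<Rightarrow> 'o \<Rightarrow> 'm \<Rightarrow> 'm \<Rightarrow> bool" where
  "entwined_module A m \<eta> X \<psi> \<delta> \<epsilon> M \<mu> \<rho> \<longleftrightarrow>
     right_module C A m \<eta> M \<mu> \<and> \<rho> \<in> hom C M (M \<odot> X) \<and>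
     \<rho> \<cdot> \<mu> = (\<mu> \<lhd> X) \<cdot> (M \<rhd> \<psi>) \<cdot> (\<rho> \<lhd> A) \<and>
     (\<rho> \<lhd> X) \<cdot> \<rho> = (\<mu> \<lhd> (X \<odot> X)) \<cdot> (M \<rhd> \<delta>) \<cdot> \<rho> \<and>
     \<mu> \<cdot> (M \<rhd> \<epsilon>) \<cdot> \<rho> = Id C M"

definition entwined_modules ::
  "'o \<Rightarrow> 'm \<Rightarrow> 'm \<Rightarrow> 'o \<Rightarrow> 'm \<Rightarrow> 'm \<Rightarrow> 'm \<Rightarrow>
   ('o \<times> 'm \<times> 'm, ('o \<times> 'm \<times> 'm) \<times> ('o \<times> 'm \<times> 'm) \<times> 'm) category" where
  "entwined_modules A m \<eta> X \<psi> \<delta> \<epsilon> =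
     \<lparr> Ob = {(M, \<mu>, \<rho>). entwined_module A m \<eta> X \<psi> \<delta> \<epsilon> M \<mu> \<rho>},
       Ar = {((M, \<mu>, \<rho>), (M', \<mu>', \<rho>'), f).
               entwined_module A m \<eta> X \<psi> \<delta> \<epsilon> M \<mu> \<rho> \<and>
               entwined_module A m \<eta> X \<psi> \<delta> \<epsilon> M' \<mu>' \<rho>' \<and>
               f \<in> hom C M M' \<and> f \<cdot> \<mu> = \<mu>' \<cdot> (f \<lhd> A) \<and> (f \<lhd> X) \<cdot> \<rho> = \<rho>' \<cdot> f},
       Dom = (\<lambda>(x, y, f). x),
       Cod = (\<lambda>(x, y, f). y),
       Id = (\<lambda>(M, \<mu>, \<rho>). ((M, \<mu>, \<rho>), (M, \<mu>, \<rho>), Id C M)),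
       Comp = (\<lambda>(y', z, g) (x, y, f). (x, z, g \<cdot> f)) \<rparr>"

end

fun forgetful_ob :: "'o \<times> 'm \<times> 'm \<Rightarrow> 'o \<times> 'm" where
  "forgetful_ob (M, \<mu>, \<rho>) = (M, \<mu>)"

fun forgetful_ar ::
  "('o \<times> 'm \<times> 'm) \<times> ('o \<times> 'm \<times> 'm) \<times> 'm \<Rightarrow> ('o \<times> 'm) \<times> ('o \<times> 'm) \<times> 'm" where
  "forgetful_ar (x, y, f) = (forgetful_ob x, forgetful_ob y, f)"

end

theory Submission
  imports Defs
begin

text \<open>
  Every \<open>f : U \<rightarrow> AV\<close> acts on a right \<open>A\<close>-module \<open>(N, \<mu>)\<close> by \<open>\<mu>V \<circ> Nf : NU \<rightarrow> NV\<close>. This turns composition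
  and tensoring of transfer morphisms into composition and whiskering, it is natural in \<open>N\<close>, and on
  \<open>N = A\<close> it is faithful. So \<open>\<C>\<^sub>A\<close> carries an action of the transfer category, \<open>(X, \<psi>)\<close> acts as a comonad
  whose comodules are the entwined modules, and the forgetful functor \<open>F\<close> is left adjoint to the cofree
  functor \<open>G = (-)X\<close>. Since right adjoints are unique, \<open>F\<close> is Frobenius iff \<open>G \<stileturn> F\<close>.

  Given \<open>t\<close> and \<open>B\<close>, the unit \<open>N \<rightarrow> NX\<close> is the action of \<open>t\<close>, and the counit is
  \<open>MX \<rightarrow> MXX \<rightarrow> M\<close>, the coaction of \<open>M\<close> followed by the action of \<open>B\<close>. Conversely, let \<open>u\<close> and \<open>c\<close> be unit
  and counit of \<open>G \<stileturn> F\<close>. As \<open>\<one>\<close> is a generator, the natural families \<open>u\<^sub>N\<close> and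
  \<open>\<tau>\<^sub>N = (NXX \<rightarrow> NX \<rightarrow> N)\<close> (\<open>c\<close> at \<open>GN\<close>, then \<open>\<epsilon>\<close>) are, for \<open>N = A\<close> and \<open>N = AX\<close>, the actions of some \<open>t\<close> and
  \<open>B\<close>. Colinearity of \<open>c\<close> at \<open>GA\<close> and its naturality along the coaction of \<open>GA\<close> give two expressions for it,
  one for each side of the Frobenius law; the triangle identities give the normalisation of \<open>t\<close> and \<open>B\<close>.
\<close>

section \<open>Categories, adjunctions and strict monoidal categories\<close>

context category
begin

lemma hom_Ob: "f \<in> hom C X Y \<Longrightarrow> X \<in> Ob C" "f \<in> hom C X Y \<Longrightarrow> Y \<in> Ob C"
  using dom_in_Ob cod_in_Ob by (auto simp: hom_def)

lemma hom_self: "f \<in> Ar C \<Longrightarrow> f \<in> hom C (Dom C f) (Cod C f)"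
  by (simp add: hom_def)

text \<open>The category axioms refer to hom-sets, whose middle object cannot be read off from a
  goal about a composite. Phrased through \<open>Ar\<close>, \<open>Dom\<close> and
  \<open>Cod\<close>, the side conditions become equations that rewriting can settle.\<close>

lemma comp_typed:
  assumes "f \<in> Ar C" "g \<in> Ar C" "Dom C g = Cod C f"
  shows "g \<cdot> f \<in> Ar C" "Dom C (g \<cdot> f) = Dom C f" "Cod C (g \<cdot> f) = Cod C g"
  using comp_in_hom[of f "Dom C f" "Cod C f" g "Cod C g"] assms by (auto simp: hom_def)

lemma id_typed:
  assumes "X \<in> Ob C"
  shows "Id C X \<in> Ar C" "Dom C (Id C X) = X" "Cod C (Id C X) = X"
  using id_in_hom[OF assms] by (auto simp: hom_def)

lemma comp_id_typed:
  "f \<in> Ar C \<Longrightarrow> Dom C f = X \<Longrightarrow> f \<cdot> Id C X = f"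
  "f \<in> Ar C \<Longrightarrow> Cod C f = X \<Longrightarrow> Id C X \<cdot> f = f"
  by (auto simp: hom_def intro!: comp_id_right comp_id_left)

lemma comp_assoc_typed:
  "f \<in> Ar C \<Longrightarrow> g \<in> Ar C \<Longrightarrow> h \<in> Ar C \<Longrightarrow> Dom C g = Cod C f \<Longrightarrow> Dom C h = Cod C g \<Longrightarrow>
    (h \<cdot> g) \<cdot> f = h \<cdot> (g \<cdot> f)"
  by (rule comp_assoc[OF hom_self]) (auto simp: hom_def)

lemmas typed = comp_typed id_typed comp_id_typed comp_assoc_typed dom_in_Ob cod_in_Ob

end

section \<open>Whiskering calculus in a strict monoidal category\<close>

context strict_monoidal_category
begin

lemma tensor_typed:
  assumes "f \<in> Ar C" "g \<in> Ar C"
  shows "f \<otimes> g \<in> Ar C" "Dom C (f \<otimes> g) = Dom C f \<odot> Dom C g" "Cod C (f \<otimes> g) = Cod C f \<odot> Cod C g"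
  using tensor_in_hom[OF hom_self hom_self, OF assms] by (auto simp: hom_def)

lemma whisker_typed:
  assumes "f \<in> Ar C" "X \<in> Ob C"
  shows "X \<rhd> f \<in> Ar C" "Dom C (X \<rhd> f) = X \<odot> Dom C f" "Cod C (X \<rhd> f) = X \<odot> Cod C f"
    and "f \<lhd> X \<in> Ar C" "Dom C (f \<lhd> X) = Dom C f \<odot> X" "Cod C (f \<lhd> X) = Cod C f \<odot> X"
  using assms by (auto simp: whisker_left_def whisker_right_def tensor_typed typed)

lemma whisker_hom [intro]:
  "f \<in> hom C X Y \<Longrightarrow> W \<in> Ob C \<Longrightarrow> W \<rhd> f \<in> hom C (W \<odot> X) (W \<odot> Y)"
  "f \<in> hom C X Y \<Longrightarrow> W \<in> Ob C \<Longrightarrow> f \<lhd> W \<in> hom C (X \<odot> W) (Y \<odot> W)"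
  by (auto simp: hom_def whisker_typed)

lemma whisker_comp:
  assumes "f \<in> Ar C" "g \<in> Ar C" "Dom C g = Cod C f" "X \<in> Ob C"
  shows "X \<rhd> (g \<cdot> f) = (X \<rhd> g) \<cdot> (X \<rhd> f)" "(g \<cdot> f) \<lhd> X = (g \<lhd> X) \<cdot> (f \<lhd> X)"
proof -
  have f: "f \<in> hom C (Dom C f) (Cod C f)" and g: "g \<in> hom C (Cod C f) (Cod C g)"
    using assms by (auto simp: hom_def)
  note i = id_in_hom[OF assms(4)]
  show "X \<rhd> (g \<cdot> f) = (X \<rhd> g) \<cdot> (X \<rhd> f)"
    using interchange[OF i i f g] comp_id_left[OF i] by (simp add: whisker_left_def)
  show "(g \<cdot> f) \<lhd> X = (g \<lhd> X) \<cdot> (f \<lhd> X)"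
    using interchange[OF f g i i] comp_id_left[OF i] by (simp add: whisker_right_def)
qed

lemma whisker_whisker:
  assumes "f \<in> Ar C" "X \<in> Ob C" "Y \<in> Ob C"
  shows "X \<rhd> (Y \<rhd> f) = (X \<odot> Y) \<rhd> f" "(f \<lhd> X) \<lhd> Y = f \<lhd> (X \<odot> Y)"
    "(X \<rhd> f) \<lhd> Y = X \<rhd> (f \<lhd> Y)"
  using assms tensor_assoc_Ar[of "Id C X" "Id C Y" f] tensor_assoc_Ar[of f "Id C X" "Id C Y"]
    tensor_assoc_Ar[of "Id C X" f "Id C Y"]
  by (auto simp: whisker_left_def whisker_right_def typed tensor_id)

lemma whisker_id:
  assumes "X \<in> Ob C" "Y \<in> Ob C"
  shows "X \<rhd> Id C Y = Id C (X \<odot> Y)" "Id C X \<lhd> Y = Id C (X \<odot> Y)"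
  using assms by (auto simp: whisker_left_def whisker_right_def tensor_id)

lemma whisker_unit:
  assumes "f \<in> Ar C"
  shows "\<one> \<rhd> f = f" "f \<lhd> \<one> = f"
  using assms by (auto simp: whisker_left_def whisker_right_def unit_left_Ar unit_right_Ar)

lemma tensor_eq_whisker:
  assumes "f \<in> Ar C" "g \<in> Ar C"
  shows "f \<otimes> g = (Cod C f \<rhd> g) \<cdot> (f \<lhd> Dom C g)" "f \<otimes> g = (f \<lhd> Cod C g) \<cdot> (Dom C f \<rhd> g)"
proof -
  note f = hom_self[OF assms(1)] and g = hom_self[OF assms(2)]
  note If = id_in_hom[OF hom_Ob(1)[OF f]] id_in_hom[OF hom_Ob(2)[OF f]]
  note Ig = id_in_hom[OF hom_Ob(1)[OF g]] id_in_hom[OF hom_Ob(2)[OF g]]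
  show "f \<otimes> g = (Cod C f \<rhd> g) \<cdot> (f \<lhd> Dom C g)"
    using interchange[OF f If(2) Ig(1) g] comp_id_left[OF f] comp_id_right[OF g]
    by (simp add: whisker_left_def whisker_right_def)
  show "f \<otimes> g = (f \<lhd> Cod C g) \<cdot> (Dom C f \<rhd> g)"
    using interchange[OF If(1) f g Ig(2)] comp_id_left[OF g] comp_id_right[OF f]
    by (simp add: whisker_left_def whisker_right_def)
qed

text \<open>Both sides are \<open>f \<otimes> g\<close>, factored in the two orders of
  \<open>tensor_eq_whisker\<close>.\<close>

lemma exchange:
  assumes "f \<in> hom C X X'" "g \<in> hom C Y Y'"
  shows "(f \<lhd> Y') \<cdot> (X \<rhd> g) = (X' \<rhd> g) \<cdot> (f \<lhd> Y)"
  using assms tensor_eq_whisker[of f g] by (auto simp: hom_def)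

text \<open>A normal form: whiskerings are pushed into composites and merged, composites and tensor
  products are bracketed to the right, units disappear. Interchange is left out because neither
  orientation is preferred; proofs apply \<open>exchange\<close> by hand where two morphisms have to
  pass each other.\<close>

lemmas mon = typed whisker_typed whisker_comp whisker_whisker whisker_id whisker_unit
  tensor_assoc_Ob unit_left_Ob unit_right_Ob tensor_in_Ob unit_in_Ob

end

section \<open>Adjunctions and the uniqueness of right adjoints\<close>

lemma left_adjointE:
  assumes "left_adjoint C D Fo Fa Go Ga"
  obtains u c where "\<And>X. X \<in> Ob C \<Longrightarrow> u X \<in> hom C X (Go (Fo X))"
      "\<And>X Y f. f \<in> hom C X Y \<Longrightarrow> u Y \<cdot>\<^bsub>C\<^esub> f = Ga (Fa f) \<cdot>\<^bsub>C\<^esub> u X"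
      "\<And>Y. Y \<in> Ob D \<Longrightarrow> c Y \<in> hom D (Fo (Go Y)) Y"
      "\<And>X Y f. f \<in> hom D X Y \<Longrightarrow> c Y \<cdot>\<^bsub>D\<^esub> Fa (Ga f) = f \<cdot>\<^bsub>D\<^esub> c X"
      "\<And>X. X \<in> Ob C \<Longrightarrow> c (Fo X) \<cdot>\<^bsub>D\<^esub> Fa (u X) = Id D (Fo X)"
      "\<And>Y. Y \<in> Ob D \<Longrightarrow> Ga (c Y) \<cdot>\<^bsub>C\<^esub> u (Go Y) = Id C (Go Y)"
proof -
  interpret F: category_functor C D Fo Fa using assms by (simp add: left_adjoint_def)
  obtain u c where
      u: "natural_transformation C C (\<lambda>X. X) (\<lambda>f. f) (\<lambda>X. Go (Fo X)) (\<lambda>f. Ga (Fa f)) u" and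
      c: "natural_transformation D D (\<lambda>Y. Fo (Go Y)) (\<lambda>f. Fa (Ga f)) (\<lambda>Y. Y) (\<lambda>f. f) c" and
      e: "\<forall>X \<in> Ob C. c (Fo X) \<cdot>\<^bsub>D\<^esub> Fa (u X) = Id D (Fo X)"
        "\<forall>Y \<in> Ob D. Ga (c Y) \<cdot>\<^bsub>C\<^esub> u (Go Y) = Id C (Go Y)"
    using assms unfolding left_adjoint_def by auto
  show thesis
    by (rule that[of u c])
      (use u c e F.C.hom_Ob F.D.hom_Ob in \<open>auto simp: natural_transformation_def\<close>)
qed

text \<open>If \<open>F \<stileturn> G\<close> and \<open>F \<stileturn> G'\<close> then the canonical isomorphism \<open>G \<cong> G'\<close>
  carries an adjunction \<open>G' \<stileturn> F\<close> over to \<open>G \<stileturn> F\<close>.\<close>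

lemma left_adjoint_transport:
  assumes FG: "left_adjoint C D Fo Fa Go Ga" and FG': "left_adjoint C D Fo Fa Go' Ga'"
    and GF': "left_adjoint D C Go' Ga' Fo Fa"
  shows "left_adjoint D C Go Ga Fo Fa"
proof -
  interpret F: category_functor C D Fo Fa using FG by (simp add: left_adjoint_def)
  interpret G: category_functor D C Go Ga using FG by (simp add: left_adjoint_def)
  interpret G': category_functor D C Go' Ga' using FG' by (simp add: left_adjoint_def)
  note nt = natural_transformation_def
  obtain u c where u: "\<And>X. X \<in> Ob C \<Longrightarrow> u X \<in> hom C X (Go (Fo X))"
      "\<And>X Y f. f \<in> hom C X Y \<Longrightarrow> u Y \<cdot>\<^bsub>C\<^esub> f = Ga (Fa f) \<cdot>\<^bsub>C\<^esub> u X"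
    and c: "\<And>Y. Y \<in> Ob D \<Longrightarrow> c Y \<in> hom D (Fo (Go Y)) Y"
      "\<And>X Y f. f \<in> hom D X Y \<Longrightarrow> c Y \<cdot>\<^bsub>D\<^esub> Fa (Ga f) = f \<cdot>\<^bsub>D\<^esub> c X"
    and uc: "\<And>X. X \<in> Ob C \<Longrightarrow> c (Fo X) \<cdot>\<^bsub>D\<^esub> Fa (u X) = Id D (Fo X)"
      "\<And>Y. Y \<in> Ob D \<Longrightarrow> Ga (c Y) \<cdot>\<^bsub>C\<^esub> u (Go Y) = Id C (Go Y)"
    by (rule left_adjointE[OF FG]) (rule that; assumption)
  obtain u' c' where u': "\<And>X. X \<in> Ob C \<Longrightarrow> u' X \<in> hom C X (Go' (Fo X))"
      "\<And>X Y f. f \<in> hom C X Y \<Longrightarrow> u' Y \<cdot>\<^bsub>C\<^esub> f = Ga' (Fa f) \<cdot>\<^bsub>C\<^esub> u' X"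
    and c': "\<And>Y. Y \<in> Ob D \<Longrightarrow> c' Y \<in> hom D (Fo (Go' Y)) Y"
      "\<And>X Y f. f \<in> hom D X Y \<Longrightarrow> c' Y \<cdot>\<^bsub>D\<^esub> Fa (Ga' f) = f \<cdot>\<^bsub>D\<^esub> c' X"
    and uc': "\<And>X. X \<in> Ob C \<Longrightarrow> c' (Fo X) \<cdot>\<^bsub>D\<^esub> Fa (u' X) = Id D (Fo X)"
      "\<And>Y. Y \<in> Ob D \<Longrightarrow> Ga' (c' Y) \<cdot>\<^bsub>C\<^esub> u' (Go' Y) = Id C (Go' Y)"
    by (rule left_adjointE[OF FG']) (rule that; assumption)
  obtain v w where v: "\<And>Y. Y \<in> Ob D \<Longrightarrow> v Y \<in> hom D Y (Fo (Go' Y))"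
      "\<And>X Y f. f \<in> hom D X Y \<Longrightarrow> v Y \<cdot>\<^bsub>D\<^esub> f = Fa (Ga' f) \<cdot>\<^bsub>D\<^esub> v X"
    and w: "\<And>X. X \<in> Ob C \<Longrightarrow> w X \<in> hom C (Go' (Fo X)) X"
      "\<And>X Y f. f \<in> hom C X Y \<Longrightarrow> w Y \<cdot>\<^bsub>C\<^esub> Ga' (Fa f) = f \<cdot>\<^bsub>C\<^esub> w X"
    and vw: "\<And>Y. Y \<in> Ob D \<Longrightarrow> w (Go' Y) \<cdot>\<^bsub>C\<^esub> Ga' (v Y) = Id C (Go' Y)"
      "\<And>X. X \<in> Ob C \<Longrightarrow> Fa (w X) \<cdot>\<^bsub>D\<^esub> v (Fo X) = Id D (Fo X)"
    by (rule left_adjointE[OF GF']) (rule that; assumption)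
  \<comment> \<open>\<open>p Y\<close> is the transpose of \<open>c Y\<close> under the adjunction
    with \<open>Go'\<close>, and \<open>q Y\<close> the transpose of \<open>c' Y\<close> under the
    one with \<open>Go\<close>. They are the two halves of the canonical isomorphism of right
    adjoints.\<close>
  define p where "p Y = Ga' (c Y) \<cdot>\<^bsub>C\<^esub> u' (Go Y)" for Y
  define q where "q Y = Ga (c' Y) \<cdot>\<^bsub>C\<^esub> u (Go' Y)" for Y
  note ob = F.ob_map G.ob_map G'.ob_map
  note ar = F.ar_map G.ar_map G'.ar_map
  note ca = F.C.comp_assoc F.D.comp_assoc
  have p: "p Y \<in> hom C (Go Y) (Go' Y)" and q: "q Y \<in> hom C (Go' Y) (Go Y)" if "Y \<in> Ob D" for Y
    unfolding p_def q_def
    using F.C.comp_in_hom[OF u'(1)[OF ob(2)[OF that]] ar(3)[OF c(1)[OF that]]]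
      F.C.comp_in_hom[OF u(1)[OF ob(3)[OF that]] ar(2)[OF c'(1)[OF that]]] by simp_all
  have p_nat: "p Z \<cdot>\<^bsub>C\<^esub> Ga f = Ga' f \<cdot>\<^bsub>C\<^esub> p Y" if f: "f \<in> hom D Y Z" for f Y Z
  proof -
    have Y: "Y \<in> Ob D" and Z: "Z \<in> Ob D" using f F.D.hom_Ob by auto
    have "p Z \<cdot>\<^bsub>C\<^esub> Ga f = Ga' (c Z) \<cdot>\<^bsub>C\<^esub> Ga' (Fa (Ga f)) \<cdot>\<^bsub>C\<^esub> u' (Go Y)"
      using u'(2)[OF ar(2)[OF f]] ca(1)[OF ar(2)[OF f] u'(1)[OF ob(2)[OF Z]] ar(3)[OF c(1)[OF Z]]]
      by (simp add: p_def)
    also have "\<dots> = Ga' (c Z \<cdot>\<^bsub>D\<^esub> Fa (Ga f)) \<cdot>\<^bsub>C\<^esub> u' (Go Y)"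
      using G'.map_comp[OF ar(1)[OF ar(2)[OF f]] c(1)[OF Z]]
        ca(1)[OF u'(1)[OF ob(2)[OF Y]] ar(3)[OF ar(1)[OF ar(2)[OF f]]] ar(3)[OF c(1)[OF Z]]]
      by simp
    also have "\<dots> = (Ga' f \<cdot>\<^bsub>C\<^esub> Ga' (c Y)) \<cdot>\<^bsub>C\<^esub> u' (Go Y)"
      using G'.map_comp[OF c(1)[OF Y] f] c(2)[OF f] by simp
    also have "\<dots> = Ga' f \<cdot>\<^bsub>C\<^esub> p Y"
      using ca(1)[OF u'(1)[OF ob(2)[OF Y]] ar(3)[OF c(1)[OF Y]] ar(3)[OF f]] by (simp add: p_def)
    finally show ?thesis .
  qed
  have q_nat: "q Z \<cdot>\<^bsub>C\<^esub> Ga' f = Ga f \<cdot>\<^bsub>C\<^esub> q Y" if f: "f \<in> hom D Y Z" for f Y Z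
  proof -
    have Y: "Y \<in> Ob D" and Z: "Z \<in> Ob D" using f F.D.hom_Ob by auto
    have "q Z \<cdot>\<^bsub>C\<^esub> Ga' f = Ga (c' Z) \<cdot>\<^bsub>C\<^esub> Ga (Fa (Ga' f)) \<cdot>\<^bsub>C\<^esub> u (Go' Y)"
      using u(2)[OF ar(3)[OF f]] ca(1)[OF ar(3)[OF f] u(1)[OF ob(3)[OF Z]] ar(2)[OF c'(1)[OF Z]]]
      by (simp add: q_def)
    also have "\<dots> = Ga (c' Z \<cdot>\<^bsub>D\<^esub> Fa (Ga' f)) \<cdot>\<^bsub>C\<^esub> u (Go' Y)"
      using G.map_comp[OF ar(1)[OF ar(3)[OF f]] c'(1)[OF Z]]
        ca(1)[OF u(1)[OF ob(3)[OF Y]] ar(2)[OF ar(1)[OF ar(3)[OF f]]] ar(2)[OF c'(1)[OF Z]]]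
      by simp
    also have "\<dots> = (Ga f \<cdot>\<^bsub>C\<^esub> Ga (c' Y)) \<cdot>\<^bsub>C\<^esub> u (Go' Y)"
      using G.map_comp[OF c'(1)[OF Y] f] c'(2)[OF f] by simp
    also have "\<dots> = Ga f \<cdot>\<^bsub>C\<^esub> q Y"
      using ca(1)[OF u(1)[OF ob(3)[OF Y]] ar(2)[OF c'(1)[OF Y]] ar(2)[OF f]] by (simp add: q_def)
    finally show ?thesis .
  qed
  \<comment> \<open>Transposing back: \<open>c'\<close> after the transpose of \<open>c Y\<close>
    returns \<open>c Y\<close>. With the triangle identities this and its mirror image
    \<open>cq\<close> make \<open>p\<close> and \<open>q\<close> mutually inverse.\<close>
  have cp: "c' Y \<cdot>\<^bsub>D\<^esub> Fa (p Y) = c Y" if Y: "Y \<in> Ob D" for Y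
  proof -
    note h1 = ar(1)[OF u'(1)[OF ob(2)[OF Y]]] and h2 = ar(1)[OF ar(3)[OF c(1)[OF Y]]]
    have "c' Y \<cdot>\<^bsub>D\<^esub> Fa (p Y) = (c' Y \<cdot>\<^bsub>D\<^esub> Fa (Ga' (c Y))) \<cdot>\<^bsub>D\<^esub> Fa (u' (Go Y))"
      using F.map_comp[OF u'(1)[OF ob(2)[OF Y]] ar(3)[OF c(1)[OF Y]]] ca(2)[OF h1 h2 c'(1)[OF Y]]
      by (simp add: p_def)
    also have "\<dots> = c Y \<cdot>\<^bsub>D\<^esub> c' (Fo (Go Y)) \<cdot>\<^bsub>D\<^esub> Fa (u' (Go Y))"
      using c'(2)[OF c(1)[OF Y]] ca(2)[OF h1 c'(1)[OF ob(1)[OF ob(2)[OF Y]]] c(1)[OF Y]] by simp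
    also have "\<dots> = c Y"
      using uc'(1)[OF ob(2)[OF Y]] F.D.comp_id_right[OF c(1)[OF Y]] by simp
    finally show ?thesis .
  qed
  have qp: "q Y \<cdot>\<^bsub>C\<^esub> p Y = Id C (Go Y)" if Y: "Y \<in> Ob D" for Y
  proof -
    note h1 = u(1)[OF ob(3)[OF Y]] and h2 = ar(2)[OF c'(1)[OF Y]]
    have "q Y \<cdot>\<^bsub>C\<^esub> p Y = Ga (c' Y) \<cdot>\<^bsub>C\<^esub> Ga (Fa (p Y)) \<cdot>\<^bsub>C\<^esub> u (Go Y)"
      using ca(1)[OF p[OF Y] h1 h2] u(2)[OF p[OF Y]] by (simp add: q_def)
    also have "\<dots> = Ga (c' Y \<cdot>\<^bsub>D\<^esub> Fa (p Y)) \<cdot>\<^bsub>C\<^esub> u (Go Y)"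
      using G.map_comp[OF ar(1)[OF p[OF Y]] c'(1)[OF Y]]
        ca(1)[OF u(1)[OF ob(2)[OF Y]] ar(2)[OF ar(1)[OF p[OF Y]]] h2] by simp
    finally show ?thesis using cp[OF Y] uc(2)[OF Y] by simp
  qed
  have cq: "c Y \<cdot>\<^bsub>D\<^esub> Fa (q Y) = c' Y" if Y: "Y \<in> Ob D" for Y
  proof -
    note h1 = ar(1)[OF u(1)[OF ob(3)[OF Y]]] and h2 = ar(1)[OF ar(2)[OF c'(1)[OF Y]]]
    have "c Y \<cdot>\<^bsub>D\<^esub> Fa (q Y) = (c Y \<cdot>\<^bsub>D\<^esub> Fa (Ga (c' Y))) \<cdot>\<^bsub>D\<^esub> Fa (u (Go' Y))"
      using F.map_comp[OF u(1)[OF ob(3)[OF Y]] ar(2)[OF c'(1)[OF Y]]] ca(2)[OF h1 h2 c(1)[OF Y]]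
      by (simp add: q_def)
    also have "\<dots> = c' Y \<cdot>\<^bsub>D\<^esub> c (Fo (Go' Y)) \<cdot>\<^bsub>D\<^esub> Fa (u (Go' Y))"
      using c(2)[OF c'(1)[OF Y]] ca(2)[OF h1 c(1)[OF ob(1)[OF ob(3)[OF Y]]] c'(1)[OF Y]] by simp
    also have "\<dots> = c' Y"
      using uc(1)[OF ob(3)[OF Y]] F.D.comp_id_right[OF c'(1)[OF Y]] by simp
    finally show ?thesis .
  qed
  have pq: "p Y \<cdot>\<^bsub>C\<^esub> q Y = Id C (Go' Y)" if Y: "Y \<in> Ob D" for Y
  proof -
    note h1 = u'(1)[OF ob(2)[OF Y]] and h2 = ar(3)[OF c(1)[OF Y]]
    have "p Y \<cdot>\<^bsub>C\<^esub> q Y = Ga' (c Y) \<cdot>\<^bsub>C\<^esub> Ga' (Fa (q Y)) \<cdot>\<^bsub>C\<^esub> u' (Go' Y)"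
      using ca(1)[OF q[OF Y] h1 h2] u'(2)[OF q[OF Y]] by (simp add: p_def)
    also have "\<dots> = Ga' (c Y \<cdot>\<^bsub>D\<^esub> Fa (q Y)) \<cdot>\<^bsub>C\<^esub> u' (Go' Y)"
      using G'.map_comp[OF ar(1)[OF q[OF Y]] c(1)[OF Y]]
        ca(1)[OF u'(1)[OF ob(3)[OF Y]] ar(3)[OF ar(1)[OF q[OF Y]]] h2] by simp
    finally show ?thesis using cq[OF Y] uc'(2)[OF Y] by simp
  qed
  \<comment> \<open>The unit and counit of the adjunction from \<open>Go'\<close> to
    \<open>Fo\<close>, corrected by \<open>q\<close> and \<open>p\<close> so that they refer to
    \<open>Go\<close>.\<close>
  define v2 where "v2 Y = Fa (q Y) \<cdot>\<^bsub>D\<^esub> v Y" for Y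
  define w2 where "w2 X = w X \<cdot>\<^bsub>C\<^esub> p (Fo X)" for X
  have v2: "v2 Y \<in> hom D Y (Fo (Go Y))" if "Y \<in> Ob D" for Y
    unfolding v2_def by (rule F.D.comp_in_hom[OF v(1)[OF that] ar(1)[OF q[OF that]]])
  have w2: "w2 X \<in> hom C (Go (Fo X)) X" if "X \<in> Ob C" for X
    unfolding w2_def by (rule F.C.comp_in_hom[OF p[OF ob(1)[OF that]] w(1)[OF that]])
  have "natural_transformation D D (\<lambda>Y. Y) (\<lambda>f. f) (\<lambda>Y. Fo (Go Y)) (\<lambda>f. Fa (Ga f)) v2"
    unfolding nt
  proof (intro conjI ballI)
    fix Y Z f assume Y: "Y \<in> Ob D" and Z: "Z \<in> Ob D" and f: "f \<in> hom D Y Z"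
    have "v2 Z \<cdot>\<^bsub>D\<^esub> f = Fa (q Z) \<cdot>\<^bsub>D\<^esub> Fa (Ga' f) \<cdot>\<^bsub>D\<^esub> v Y"
      using ca(2)[OF f v(1)[OF Z] ar(1)[OF q[OF Z]]] v(2)[OF f] by (simp add: v2_def)
    also have "\<dots> = Fa (q Z \<cdot>\<^bsub>C\<^esub> Ga' f) \<cdot>\<^bsub>D\<^esub> v Y"
      using F.map_comp[OF ar(3)[OF f] q[OF Z]]
        ca(2)[OF v(1)[OF Y] ar(1)[OF ar(3)[OF f]] ar(1)[OF q[OF Z]]] by simp
    also have "\<dots> = Fa (Ga f) \<cdot>\<^bsub>D\<^esub> v2 Y"
      using F.map_comp[OF q[OF Y] ar(2)[OF f]] q_nat[OF f]
        ca(2)[OF v(1)[OF Y] ar(1)[OF q[OF Y]] ar(1)[OF ar(2)[OF f]]] by (simp add: v2_def)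
    finally show "v2 Z \<cdot>\<^bsub>D\<^esub> f = Fa (Ga f) \<cdot>\<^bsub>D\<^esub> v2 Y" .
  qed (rule v2)
  moreover have "natural_transformation C C (\<lambda>X. Go (Fo X)) (\<lambda>f. Ga (Fa f)) (\<lambda>X. X) (\<lambda>f. f) w2"
    unfolding nt
  proof (intro conjI ballI)
    fix X Y f assume X: "X \<in> Ob C" and Y: "Y \<in> Ob C" and f: "f \<in> hom C X Y"
    note pX = p[OF ob(1)[OF X]] and pY = p[OF ob(1)[OF Y]]
    have "w2 Y \<cdot>\<^bsub>C\<^esub> Ga (Fa f) = w Y \<cdot>\<^bsub>C\<^esub> Ga' (Fa f) \<cdot>\<^bsub>C\<^esub> p (Fo X)"
      using ca(1)[OF ar(2)[OF ar(1)[OF f]] pY w(1)[OF Y]] p_nat[OF ar(1)[OF f]] by (simp add: w2_def)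
    also have "\<dots> = (f \<cdot>\<^bsub>C\<^esub> w X) \<cdot>\<^bsub>C\<^esub> p (Fo X)"
      using ca(1)[OF pX ar(3)[OF ar(1)[OF f]] w(1)[OF Y]] w(2)[OF f] by simp
    also have "\<dots> = f \<cdot>\<^bsub>C\<^esub> w2 X"
      using ca(1)[OF pX w(1)[OF X] f] by (simp add: w2_def)
    finally show "w2 Y \<cdot>\<^bsub>C\<^esub> Ga (Fa f) = f \<cdot>\<^bsub>C\<^esub> w2 X" .
  qed (rule w2)
  moreover have "w2 (Go Y) \<cdot>\<^bsub>C\<^esub> Ga (v2 Y) = Id C (Go Y)" if Y: "Y \<in> Ob D" for Y
  proof -
    note GY = ob(2)[OF Y] and G'Y = ob(3)[OF Y] and qY = q[OF Y]
    have "w2 (Go Y) \<cdot>\<^bsub>C\<^esub> Ga (v2 Y) = w (Go Y) \<cdot>\<^bsub>C\<^esub> Ga' (v2 Y) \<cdot>\<^bsub>C\<^esub> p Y"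
      using ca(1)[OF ar(2)[OF v2[OF Y]] p[OF ob(1)[OF GY]] w(1)[OF GY]] p_nat[OF v2[OF Y]]
      by (simp add: w2_def)
    also have "\<dots> = (w (Go Y) \<cdot>\<^bsub>C\<^esub> Ga' (v2 Y)) \<cdot>\<^bsub>C\<^esub> p Y"
      using ca(1)[OF p[OF Y] ar(3)[OF v2[OF Y]] w(1)[OF GY]] by simp
    \<comment> \<open>Naturality of \<open>w\<close> along \<open>q Y\<close> exposes the old
      triangle identity; what remains is \<open>q Y\<close>, which cancels against
      \<open>p Y\<close>.\<close>
    also have "w (Go Y) \<cdot>\<^bsub>C\<^esub> Ga' (v2 Y) = (w (Go Y) \<cdot>\<^bsub>C\<^esub> Ga' (Fa (q Y))) \<cdot>\<^bsub>C\<^esub> Ga' (v Y)"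
      using G'.map_comp[OF v(1)[OF Y] ar(1)[OF qY]]
        ca(1)[OF ar(3)[OF v(1)[OF Y]] ar(3)[OF ar(1)[OF qY]] w(1)[OF GY]] by (simp add: v2_def)
    also have "\<dots> = q Y \<cdot>\<^bsub>C\<^esub> w (Go' Y) \<cdot>\<^bsub>C\<^esub> Ga' (v Y)"
      using w(2)[OF qY] ca(1)[OF ar(3)[OF v(1)[OF Y]] w(1)[OF G'Y] qY] by simp
    also have "\<dots> = q Y"
      using vw(1)[OF Y] F.C.comp_id_right[OF qY] by simp
    finally show ?thesis using qp[OF Y] by simp
  qed
  moreover have "Fa (w2 X) \<cdot>\<^bsub>D\<^esub> v2 (Fo X) = Id D (Fo X)" if X: "X \<in> Ob C" for X
  proof -
    note FX = ob(1)[OF X]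
    note pX = p[OF FX] and qX = q[OF FX] and wX = w(1)[OF X] and vX = v(1)[OF FX]
    have "w2 X \<cdot>\<^bsub>C\<^esub> q (Fo X) = w X"
      using ca(1)[OF qX pX wX] pq[OF FX] F.C.comp_id_right[OF wX] by (simp add: w2_def)
    then have "(Fa (w2 X) \<cdot>\<^bsub>D\<^esub> Fa (q (Fo X))) \<cdot>\<^bsub>D\<^esub> v (Fo X) = Id D (Fo X)"
      using F.map_comp[OF qX w2[OF X]] vw(2)[OF X] by simp
    then show ?thesis
      using ca(2)[OF vX ar(1)[OF qX] ar(1)[OF w2[OF X]]] by (simp add: v2_def)
  qed
  ultimately show ?thesis
    using F.category_functor_axioms G.category_functor_axioms by (auto simp: left_adjoint_def)
qed

section \<open>The action of transfer morphisms on modules\<close>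

locale monoidal_algebra = strict_monoidal_category C
  for C :: "('o, 'm, 'z) monoidal_category_scheme" (structure) +
  fixes A :: 'o and m \<eta> :: 'm
  assumes alg: "algebra C A m \<eta>"
begin

lemma A: "A \<in> Ob C" "m \<in> Ar C" "Dom C m = A \<odot> A" "Cod C m = A"
    "\<eta> \<in> Ar C" "Dom C \<eta> = \<one>" "Cod C \<eta> = A"
  and m_assoc: "m \<cdot> (m \<lhd> A) = m \<cdot> (A \<rhd> m)"
  and m_unit: "m \<cdot> (\<eta> \<lhd> A) = Id C A" "m \<cdot> (A \<rhd> \<eta>) = Id C A"
  using alg by (auto simp: algebra_def hom_def)

definition act where "act N \<mu> V f = (\<mu> \<lhd> V) \<cdot> (N \<rhd> f)"

abbreviation "module N \<mu> \<equiv> right_module C A m \<eta> N \<mu>"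

abbreviation "linear N \<mu> N' \<mu>' h \<equiv> h \<in> hom C N N' \<and> h \<cdot> \<mu> = \<mu>' \<cdot> (h \<lhd> A)"

lemma module:
  assumes "module N \<mu>"
  shows "N \<in> Ob C" "\<mu> \<in> Ar C" "Dom C \<mu> = N \<odot> A" "Cod C \<mu> = N" "\<mu> \<in> hom C (N \<odot> A) N"
    "\<mu> \<cdot> (\<mu> \<lhd> A) = \<mu> \<cdot> (N \<rhd> m)" "\<mu> \<cdot> (N \<rhd> \<eta>) = Id C N"
  using assms by (auto simp: right_module_def hom_def)

lemma module_A: "module A m"
  using alg by (simp add: algebra_def right_module_def)

lemma act_hom:
  assumes "module N \<mu>" "f \<in> hom C U (A \<odot> V)" "V \<in> Ob C"
  shows "act N \<mu> V f \<in> hom C (N \<odot> U) (N \<odot> V)"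
  using assms(2-) hom_Ob[OF assms(2)] module(1-4)[OF assms(1)] A by (auto simp: hom_def mon act_def)

text \<open>Associativity of \<open>\<mu>\<close> splits the action of a product into two successive
  actions, and interchange moves the first of them past \<open>g\<close>. Since \<open>f\<close> and
  \<open>g\<close> are arbitrary morphisms into \<open>AV\<close> and \<open>AW\<close>, a structure
  map \<open>\<psi>\<close> may itself be one of the factors.\<close>

lemma act_comp:
  assumes N: "module N \<mu>" and f: "f \<in> hom C U (A \<odot> V)" and g: "g \<in> hom C V (A \<odot> W)"
    and V: "V \<in> Ob C" and W: "W \<in> Ob C"
  shows "act N \<mu> W ((m \<lhd> W) \<cdot> (A \<rhd> g) \<cdot> f) = act N \<mu> W g \<cdot> act N \<mu> V f"
proof -
  note N' = module[OF N]
  note t = f[unfolded hom_def] g[unfolded hom_def] V W N'(1-4) A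
  have 1: "(\<mu> \<lhd> W) \<cdot> (N \<rhd> (m \<lhd> W)) = (\<mu> \<lhd> W) \<cdot> (\<mu> \<lhd> (A \<odot> W))"
    using arg_cong[OF N'(6), of "\<lambda>x. x \<lhd> W"] t by (simp add: mon)
  have 2: "(\<mu> \<lhd> (A \<odot> W)) \<cdot> ((N \<odot> A) \<rhd> g) = (N \<rhd> g) \<cdot> (\<mu> \<lhd> V)"
    by (rule exchange[OF N'(5) g])
  have "act N \<mu> W ((m \<lhd> W) \<cdot> (A \<rhd> g) \<cdot> f)
      = ((\<mu> \<lhd> W) \<cdot> (N \<rhd> (m \<lhd> W))) \<cdot> ((N \<odot> A) \<rhd> g) \<cdot> (N \<rhd> f)"
    using t by (simp add: mon act_def)
  also have "\<dots> = (\<mu> \<lhd> W) \<cdot> ((\<mu> \<lhd> (A \<odot> W)) \<cdot> ((N \<odot> A) \<rhd> g)) \<cdot> (N \<rhd> f)"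
    unfolding 1 using t by (simp add: mon)
  also have "\<dots> = act N \<mu> W g \<cdot> act N \<mu> V f"
    unfolding 2 using t by (simp add: mon act_def)
  finally show ?thesis .
qed

text \<open>Linearity moves \<open>h\<close> past \<open>\<mu>\<close>, and interchange moves it
  past \<open>f\<close>.\<close>

lemma act_natural:
  assumes N: "module N \<mu>" "module N' \<mu>'" and h: "linear N \<mu> N' \<mu>' h"
    and f: "f \<in> hom C U (A \<odot> V)" and V: "V \<in> Ob C"
  shows "(h \<lhd> V) \<cdot> act N \<mu> V f = act N' \<mu>' V f \<cdot> (h \<lhd> U)"
proof -
  note n = module[OF N(1)] and n' = module[OF N(2)]
  have h': "h \<in> Ar C" "Dom C h = N" "Cod C h = N'" using h by (auto simp: hom_def)
  note t = f[unfolded hom_def] V hom_Ob[OF f] h' n(1-4) n'(1-4) A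
  have 1: "(h \<lhd> V) \<cdot> (\<mu> \<lhd> V) = (\<mu>' \<lhd> V) \<cdot> (h \<lhd> (A \<odot> V))"
    using arg_cong[of _ _ "\<lambda>x. x \<lhd> V", OF conjunct2[OF h]] t by (simp add: mon)
  have 2: "(h \<lhd> (A \<odot> V)) \<cdot> (N \<rhd> f) = (N' \<rhd> f) \<cdot> (h \<lhd> U)"
    by (rule exchange[OF _ f]) (use h in auto)
  have "(h \<lhd> V) \<cdot> act N \<mu> V f = ((h \<lhd> V) \<cdot> (\<mu> \<lhd> V)) \<cdot> (N \<rhd> f)"
    using t by (simp add: mon act_def)
  also have "\<dots> = (\<mu>' \<lhd> V) \<cdot> ((h \<lhd> (A \<odot> V)) \<cdot> (N \<rhd> f))"
    unfolding 1 using t by (simp add: mon)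
  also have "\<dots> = act N' \<mu>' V f \<cdot> (h \<lhd> U)"
    unfolding 2 using t by (simp add: mon act_def)
  finally show ?thesis .
qed

lemma act_whisker:
  assumes "module N \<mu>" "f \<in> hom C U (A \<odot> V)" "V \<in> Ob C" "W \<in> Ob C"
  shows "act N \<mu> (V \<odot> W) (f \<lhd> W) = act N \<mu> V f \<lhd> W"
  using assms(2-) hom_Ob[OF assms(2)] module(1-4)[OF assms(1)] A by (simp add: hom_def mon act_def)

text \<open>The morphism acting on the left is the one that left whiskering by a transfer object
  produces (see \<open>whisker_left_T\<close>). On modules, whiskering on that side therefore means
  evaluating the action at \<open>NX\<close> instead of \<open>N\<close>.\<close>

lemma act_tensor:
  assumes "module N \<mu>" "f \<in> hom C U (A \<odot> V)" "V \<in> Ob C" "X \<in> Ob C" "\<psi> \<in> hom C (X \<odot> A) (A \<odot> X)"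
  shows "act N \<mu> (X \<odot> V) ((\<psi> \<lhd> V) \<cdot> (X \<rhd> f)) = act (N \<odot> X) (act N \<mu> X \<psi>) V f"
  using assms(2-) hom_Ob[OF assms(2)] module(1-4)[OF assms(1)] A by (simp add: hom_def mon act_def)

lemma act_precomp:
  assumes "module N \<mu>" "f \<in> hom C U (A \<odot> V)" "V \<in> Ob C" "k \<in> hom C W U"
  shows "act N \<mu> V (f \<cdot> k) = act N \<mu> V f \<cdot> (N \<rhd> k)"
  using assms(2-) hom_Ob[OF assms(2)] module(1-4)[OF assms(1)] A by (simp add: hom_def mon act_def)

lemma act_eta:
  assumes N: "module N \<mu>" and V: "V \<in> Ob C"
  shows "act N \<mu> V (\<eta> \<lhd> V) = Id C (N \<odot> V)"
proof -
  note n = module[OF N]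
  have "(\<mu> \<cdot> (N \<rhd> \<eta>)) \<lhd> V = Id C (N \<odot> V)"
    unfolding n(7) using n V by (simp add: mon)
  then show ?thesis
    using n(1-4) V A by (simp add: mon act_def)
qed

text \<open>Interchange moves \<open>\<eta>\<close> past \<open>f\<close>, and the left unit law
  absorbs it. So \<open>f\<close> can be recovered from its action on \<open>A\<close>, which is the
  faithfulness recorded in \<open>act_A_inject\<close>.\<close>

lemma act_A_eta:
  assumes f: "f \<in> hom C U (A \<odot> V)" and V: "V \<in> Ob C"
  shows "act A m V f \<cdot> (\<eta> \<lhd> U) = f"
proof -
  note t = f[unfolded hom_def] V A
  have e: "\<eta> \<in> hom C \<one> A" using A by (simp add: hom_def)
  have "(m \<lhd> V) \<cdot> (\<eta> \<lhd> (A \<odot> V)) = Id C (A \<odot> V)"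
    using arg_cong[OF m_unit(1), of "\<lambda>x. x \<lhd> V"] t by (simp add: mon)
  then have "((m \<lhd> V) \<cdot> (\<eta> \<lhd> (A \<odot> V))) \<cdot> f = f"
    using t by (simp add: mon)
  then show ?thesis
    using exchange[OF e f] t hom_Ob[OF f] by (simp add: mon act_def)
qed

lemma act_A_inject:
  assumes "f \<in> hom C U (A \<odot> V)" "g \<in> hom C U (A \<odot> V)" "V \<in> Ob C" "act A m V f = act A m V g"
  shows "f = g"
  by (metis act_A_eta assms)

section \<open>Transfer objects and morphisms acting on modules\<close>

abbreviation "transfer \<equiv> transfer_object C A m \<eta>"

text \<open>The bare condition on a morphism of \<open>C\<close>, without the triples and without
  the axioms for the end points; \<open>hom_T\<close> supplies both.\<close>

definition transfer_mor where
  "transfer_mor U \<psi> V \<phi> f \<longleftrightarrow> f \<in> hom C U (A \<odot> V) \<and>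
     (m \<lhd> V) \<cdot> (A \<rhd> f) \<cdot> \<psi> = (m \<lhd> V) \<cdot> (A \<rhd> \<phi>) \<cdot> (f \<lhd> A)"

lemma transfer:
  assumes "transfer X \<psi>"
  shows "X \<in> Ob C" "\<psi> \<in> hom C (X \<odot> A) (A \<odot> X)" "\<psi> \<in> Ar C" "Dom C \<psi> = X \<odot> A" "Cod C \<psi> = A \<odot> X"
    "\<psi> \<cdot> (X \<rhd> m) = (m \<lhd> X) \<cdot> (A \<rhd> \<psi>) \<cdot> (\<psi> \<lhd> A)" "\<psi> \<cdot> (X \<rhd> \<eta>) = \<eta> \<lhd> X"
  using assms by (auto simp: transfer_object_def hom_def)

text \<open>Acting with both sides of the multiplication axiom of \<open>\<psi>\<close> gives
  associativity of the new action; acting with both sides of the unit axiom gives unitality.\<close>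

lemma act_module:
  assumes N: "module N \<mu>" and X: "transfer X \<psi>"
  shows "module (N \<odot> X) (act N \<mu> X \<psi>)"
proof -
  note n = module[OF N] and x = transfer[OF X]
  have h: "act N \<mu> X \<psi> \<in> hom C (N \<odot> X \<odot> A) (N \<odot> X)"
    by (rule act_hom[OF N x(2,1)])
  have "act N \<mu> X (\<psi> \<cdot> (X \<rhd> m)) = act N \<mu> X \<psi> \<cdot> (N \<rhd> (X \<rhd> m))"
    by (rule act_precomp[OF N x(2,1)]) (use x A in \<open>auto simp: hom_def mon\<close>)
  moreover have "act N \<mu> X (\<psi> \<cdot> (X \<rhd> m)) = act N \<mu> X \<psi> \<cdot> act N \<mu> (X \<odot> A) (\<psi> \<lhd> A)"
    unfolding x(6) by (rule act_comp[OF N _ x(2)]) (use x(1-5) A in \<open>auto simp: hom_def mon\<close>)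
  moreover have "act N \<mu> (X \<odot> A) (\<psi> \<lhd> A) = act N \<mu> X \<psi> \<lhd> A"
    by (rule act_whisker[OF N x(2,1) A(1)])
  moreover have "act N \<mu> X (\<psi> \<cdot> (X \<rhd> \<eta>)) = act N \<mu> X \<psi> \<cdot> (N \<rhd> (X \<rhd> \<eta>))"
    by (rule act_precomp[OF N x(2,1)]) (use x(1-5) A in \<open>auto simp: hom_def mon\<close>)
  ultimately show ?thesis
    using h n(1-4) x(1-5) A act_eta[OF N x(1)] unfolding x(7)
    by (simp add: right_module_def mon)
qed

lemma act_module_tensor:
  assumes "module N \<mu>" "transfer X \<psi>" "transfer Y \<phi>"
  shows "act N \<mu> (X \<odot> Y) ((\<psi> \<lhd> Y) \<cdot> (X \<rhd> \<phi>)) = act (N \<odot> X) (act N \<mu> X \<psi>) Y \<phi>"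
  using assms transfer by (intro act_tensor) auto

lemma act_module_one: "module N \<mu> \<Longrightarrow> act N \<mu> \<one> (Id C A) = \<mu>"
  using module(1-4)[of N \<mu>] A by (simp add: act_def mon)

lemma linear_comp:
  assumes "linear N \<mu> N' \<mu>' f" "linear N' \<mu>' N'' \<mu>'' g" "module N \<mu>" "module N' \<mu>'" "module N'' \<mu>''"
  shows "linear N \<mu> N'' \<mu>'' (g \<cdot> f)"
proof -
  have f: "f \<in> Ar C" "Dom C f = N" "Cod C f = N'" and g: "g \<in> Ar C" "Dom C g = N'" "Cod C g = N''"
    using assms by (auto simp: hom_def)
  note t = f g module(1-4)[OF assms(3)] module(1-4)[OF assms(4)] module(1-4)[OF assms(5)] A
  have "(g \<cdot> f) \<cdot> \<mu> = g \<cdot> (f \<cdot> \<mu>)" using t by (simp add: mon)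
  also have "\<dots> = (g \<cdot> \<mu>') \<cdot> (f \<lhd> A)" using assms(1) t by (simp add: mon)
  also have "\<dots> = (\<mu>'' \<cdot> (g \<lhd> A)) \<cdot> (f \<lhd> A)" using assms(2) by simp
  also have "\<dots> = \<mu>'' \<cdot> ((g \<cdot> f) \<lhd> A)" using t by (simp add: mon)
  finally show ?thesis using t by (simp add: mon hom_def)
qed

lemma linear_id: "module N \<mu> \<Longrightarrow> linear N \<mu> N \<mu> (Id C N)"
  using module(1-4)[of N \<mu>] A by (simp add: mon hom_def)

lemma linear_whisker:
  assumes N: "module N \<mu>" "module N' \<mu>'" and h: "linear N \<mu> N' \<mu>' h" and X: "transfer X \<psi>"
  shows "linear (N \<odot> X) (act N \<mu> X \<psi>) (N' \<odot> X) (act N' \<mu>' X \<psi>) (h \<lhd> X)"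
  using act_natural[OF N h transfer(2,1)[OF X]] h transfer(1)[OF X] A
  by (auto simp: hom_def mon)

text \<open>Acting on \<open>N\<close> with both sides of the equation that defines a transfer
  morphism yields the two sides of linearity.\<close>

lemma linear_act:
  assumes N: "module N \<mu>" and U: "transfer U \<psi>" and V: "transfer V \<phi>" and f: "transfer_mor U \<psi> V \<phi> f"
  shows "linear (N \<odot> U) (act N \<mu> U \<psi>) (N \<odot> V) (act N \<mu> V \<phi>) (act N \<mu> V f)"
proof -
  note u = transfer[OF U] and v = transfer[OF V]
  have fh: "f \<in> hom C U (A \<odot> V)" and fe: "(m \<lhd> V) \<cdot> (A \<rhd> f) \<cdot> \<psi> = (m \<lhd> V) \<cdot> (A \<rhd> \<phi>) \<cdot> (f \<lhd> A)"
    using f by (auto simp: transfer_mor_def)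
  have fA: "f \<lhd> A \<in> hom C (U \<odot> A) (A \<odot> V \<odot> A)"
    using fh A(1) u(1) v(1) by (auto simp: hom_def mon)
  have "act N \<mu> V f \<cdot> act N \<mu> U \<psi> = act N \<mu> V \<phi> \<cdot> act N \<mu> (V \<odot> A) (f \<lhd> A)"
    using act_comp[OF N u(2) fh u(1) v(1)] act_comp[OF N fA v(2) _ v(1)] fe v(1) A(1) tensor_in_Ob
    by simp
  then show ?thesis
    using act_whisker[OF N fh v(1) A(1)] act_hom[OF N fh v(1)] by simp
qed

text \<open>Converse of \<open>linear_act\<close>, from faithfulness of the action on
  \<open>A\<close>. It produces transfer morphisms out of the components at \<open>A\<close> of
  natural families.\<close>

lemma transfer_mor_if_linear:
  assumes U: "transfer U \<psi>" and V: "transfer V \<phi>" and fh: "f \<in> hom C U (A \<odot> V)"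
    and lin: "linear (A \<odot> U) (act A m U \<psi>) (A \<odot> V) (act A m V \<phi>) (act A m V f)"
  shows "transfer_mor U \<psi> V \<phi> f"
proof -
  note u = transfer[OF U] and v = transfer[OF V] and N = module_A
  have fA: "f \<lhd> A \<in> hom C (U \<odot> A) (A \<odot> V \<odot> A)"
    using fh A(1) u(1) v(1) by (auto simp: hom_def mon)
  have "act A m V ((m \<lhd> V) \<cdot> (A \<rhd> f) \<cdot> \<psi>) = act A m V ((m \<lhd> V) \<cdot> (A \<rhd> \<phi>) \<cdot> (f \<lhd> A))"
    using act_comp[OF N u(2) fh u(1) v(1)] act_comp[OF N fA v(2) _ v(1)] v(1) A(1) tensor_in_Ob lin
      act_whisker[OF N fh v(1) A(1)] by simp
  then have "(m \<lhd> V) \<cdot> (A \<rhd> f) \<cdot> \<psi> = (m \<lhd> V) \<cdot> (A \<rhd> \<phi>) \<cdot> (f \<lhd> A)"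
    by (rule act_A_inject[rotated 3]) (use fh u(1-5) v(1-5) A in \<open>auto simp: hom_def mon\<close>)
  with fh show ?thesis by (simp add: transfer_mor_def)
qed

section \<open>The transfer category through underlying morphisms\<close>

abbreviation "T \<equiv> transfer_category C A m \<eta>"

lemma hom_T:
  "z \<in> hom T (U, \<psi>) (V, \<phi>) \<longleftrightarrow>
     (\<exists>f. z = ((U, \<psi>), (V, \<phi>), f) \<and> transfer U \<psi> \<and> transfer V \<phi> \<and> transfer_mor U \<psi> V \<phi> f)"
  unfolding hom_def by (auto simp: transfer_category_def transfer_mor_def)

lemma comp_T: "(y', (W, \<omega>), g) \<cdot>\<^bsub>T\<^esub> (x, y, f) = (x, (W, \<omega>), (m \<lhd> W) \<cdot> (A \<rhd> g) \<cdot> f)"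
  by (simp add: transfer_category_def)

lemma tensorOb_T: "(U, \<psi>) \<odot>\<^bsub>T\<^esub> (V, \<phi>) = (U \<odot> V, (\<psi> \<lhd> V) \<cdot> (U \<rhd> \<phi>))"
  by (simp add: transfer_category_def)

lemma unit_T: "\<one>\<^bsub>T\<^esub> = (\<one>, Id C A)"
  by (simp add: transfer_category_def)

lemma id_T: "Id T (U, \<psi>) = ((U, \<psi>), (U, \<psi>), \<eta> \<lhd> U)"
  by (simp add: transfer_category_def)

lemma transfer_unit: "transfer \<one> (Id C A)"
  using A by (simp add: transfer_object_def hom_def mon)

lemma transfer_tensor_one:
  assumes "transfer X \<psi>"
  shows "(X, \<psi>) \<odot>\<^bsub>T\<^esub> \<one>\<^bsub>T\<^esub> = (X, \<psi>)" "\<one>\<^bsub>T\<^esub> \<odot>\<^bsub>T\<^esub> (X, \<psi>) = (X, \<psi>)"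
  using transfer(1-5)[OF assms] A by (simp_all add: tensorOb_T unit_T mon)

lemma eta_m_whisker: "V \<in> Ob C \<Longrightarrow> (m \<lhd> V) \<cdot> (\<eta> \<lhd> (A \<odot> V)) = Id C (A \<odot> V)"
  using arg_cong[OF m_unit(1), of "\<lambda>x. x \<lhd> V"] A by (simp add: mon)

lemma whisker_left_T:
  assumes Z: "transfer Z \<zeta>" and f: "f \<in> hom C U (A \<odot> V)" and V: "V \<in> Ob C"
  shows "(Z, \<zeta>) \<rhd>\<^bsub>T\<^esub> ((U, \<psi>), (V, \<phi>), f) =
     ((Z, \<zeta>) \<odot>\<^bsub>T\<^esub> (U, \<psi>), (Z, \<zeta>) \<odot>\<^bsub>T\<^esub> (V, \<phi>), (\<zeta> \<lhd> V) \<cdot> (Z \<rhd> f))"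
proof -
  note t = f[unfolded hom_def] hom_Ob[OF f] V transfer(1-5)[OF Z] A
  have e: "\<eta> \<in> hom C \<one> A" using A by (simp add: hom_def)
  have z: "\<zeta> \<lhd> V \<in> hom C (Z \<odot> A \<odot> V) (A \<odot> Z \<odot> V)" using t by (simp add: hom_def mon)
  have "(\<eta> \<lhd> Z) \<otimes> f = (\<eta> \<lhd> (Z \<odot> A \<odot> V)) \<cdot> (Z \<rhd> f)"
    using tensor_eq_whisker(2)[of "\<eta> \<lhd> Z" f] t by (simp add: mon)
  moreover have "(A \<rhd> (\<zeta> \<lhd> V)) \<cdot> (\<eta> \<lhd> (Z \<odot> A \<odot> V)) = (\<eta> \<lhd> (A \<odot> Z \<odot> V)) \<cdot> (\<zeta> \<lhd> V)"
    using exchange[OF e z] t by (simp add: mon)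
  ultimately have "(m \<lhd> (Z \<odot> V)) \<cdot> (A \<rhd> \<zeta> \<lhd> V) \<cdot> ((\<eta> \<lhd> Z) \<otimes> f)
      = (m \<lhd> (Z \<odot> V)) \<cdot> ((\<eta> \<lhd> (A \<odot> Z \<odot> V)) \<cdot> (\<zeta> \<lhd> V)) \<cdot> (Z \<rhd> f)"
    using t by (simp add: mon comp_assoc_typed[symmetric] del: comp_assoc_typed)
  also have "\<dots> = ((m \<lhd> (Z \<odot> V)) \<cdot> (\<eta> \<lhd> (A \<odot> Z \<odot> V))) \<cdot> (\<zeta> \<lhd> V) \<cdot> (Z \<rhd> f)"
    using t by (simp add: mon)
  also have "\<dots> = (\<zeta> \<lhd> V) \<cdot> (Z \<rhd> f)"
    using t by (subst eta_m_whisker) (simp_all add: mon)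
  finally show ?thesis
    by (simp add: whisker_left_def[of T] id_T) (simp add: transfer_category_def)
qed

lemma whisker_right_T:
  assumes Z: "transfer Z \<zeta>" and Y: "transfer V \<phi>" and f: "f \<in> hom C U (A \<odot> V)"
  shows "((U, \<psi>), (V, \<phi>), f) \<lhd>\<^bsub>T\<^esub> (Z, \<zeta>) =
     ((U, \<psi>) \<odot>\<^bsub>T\<^esub> (Z, \<zeta>), (V, \<phi>) \<odot>\<^bsub>T\<^esub> (Z, \<zeta>), f \<lhd> Z)"
proof -
  note y = transfer[OF Y]
  note t = f[unfolded hom_def] hom_Ob[OF f] transfer(1-5)[OF Z] y(1-5) A
  have 1: "f \<otimes> (\<eta> \<lhd> Z) = (A \<rhd> V \<rhd> \<eta> \<lhd> Z) \<cdot> (f \<lhd> Z)"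
    using tensor_eq_whisker(1)[of f "\<eta> \<lhd> Z"] t by (simp add: mon)
  have 2: "(A \<rhd> \<phi> \<lhd> Z) \<cdot> (A \<rhd> V \<rhd> \<eta> \<lhd> Z) = A \<rhd> \<eta> \<lhd> (V \<odot> Z)"
    using arg_cong[OF y(7), of "\<lambda>x. A \<rhd> x \<lhd> Z"] t by (simp add: mon)
  have 3: "(m \<lhd> (V \<odot> Z)) \<cdot> (A \<rhd> \<eta> \<lhd> (V \<odot> Z)) = Id C (A \<odot> V \<odot> Z)"
    using arg_cong[OF m_unit(2), of "\<lambda>x. x \<lhd> (V \<odot> Z)"] t by (simp add: mon)
  have "(m \<lhd> (V \<odot> Z)) \<cdot> (A \<rhd> \<phi> \<lhd> Z) \<cdot> (f \<otimes> (\<eta> \<lhd> Z))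
      = (m \<lhd> (V \<odot> Z)) \<cdot> ((A \<rhd> \<phi> \<lhd> Z) \<cdot> (A \<rhd> V \<rhd> \<eta> \<lhd> Z)) \<cdot> (f \<lhd> Z)"
    unfolding 1 using t by (simp add: mon)
  also have "\<dots> = ((m \<lhd> (V \<odot> Z)) \<cdot> (A \<rhd> \<eta> \<lhd> (V \<odot> Z))) \<cdot> (f \<lhd> Z)"
    unfolding 2 using t by (simp add: mon)
  also have "\<dots> = f \<lhd> Z"
    unfolding 3 using t by (simp add: mon)
  finally show ?thesis
    by (simp add: whisker_right_def[of T] id_T) (simp add: transfer_category_def)
qed

section \<open>Coalgebras in the transfer category and entwined modules\<close>

lemma in_Ob_T: "(U, \<psi>) \<in> Ob T \<longleftrightarrow> transfer U \<psi>"
  by (simp add: transfer_category_def)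

lemma transfer_mor_hom: "transfer_mor U \<psi> V \<phi> f \<Longrightarrow> f \<in> hom C U (A \<odot> V)"
  by (simp add: transfer_mor_def)

end

locale transfer_coalgebra = monoidal_algebra C A m \<eta>
  for C :: "('o, 'm, 'z) monoidal_category_scheme" (structure) and A m \<eta> +
  fixes X :: 'o and \<psi> \<delta> \<epsilon> :: 'm
  assumes coalg: "coalgebra (transfer_category C A m \<eta>) (X, \<psi>)
    (transfer_comult C A m \<eta> X \<psi> \<delta>) (transfer_counit C A m \<eta> X \<psi> \<epsilon>)"
begin

definition "\<psi>\<^sub>2 = (\<psi> \<lhd> X) \<cdot> (X \<rhd> \<psi>)"

lemma tensor_XX: "(X, \<psi>) \<odot>\<^bsub>T\<^esub> (X, \<psi>) = (X \<odot> X, \<psi>\<^sub>2)"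
  by (simp add: tensorOb_T \<psi>\<^sub>2_def)

lemma trX: "transfer X \<psi>"
  using coalg by (simp add: coalgebra_def in_Ob_T)

lemmas X = transfer(1-5)[OF trX]

lemma \<delta>: "transfer_mor X \<psi> (X \<odot> X) \<psi>\<^sub>2 \<delta>" and trXX: "transfer (X \<odot> X) \<psi>\<^sub>2"
  using coalg by (auto simp: coalgebra_def tensor_XX hom_T transfer_comult_def)

lemma \<epsilon>: "transfer_mor X \<psi> \<one> (Id C A) \<epsilon>"
  using coalg by (auto simp: coalgebra_def unit_T hom_T transfer_counit_def)

lemma \<delta>_hom: "\<delta> \<in> hom C X (A \<odot> X \<odot> X)" and \<epsilon>_hom: "\<epsilon> \<in> hom C X (A \<odot> \<one>)"
  using \<delta> \<epsilon> by (auto simp: transfer_mor_def)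

lemma comult_T: "transfer_comult C A m \<eta> X \<psi> \<delta> = ((X, \<psi>), (X \<odot> X, \<psi>\<^sub>2), \<delta>)"
  by (simp add: transfer_comult_def tensor_XX)

lemma counit_T: "transfer_counit C A m \<eta> X \<psi> \<epsilon> = ((X, \<psi>), (\<one>, Id C A), \<epsilon>)"
  by (simp add: transfer_counit_def unit_T)

lemma comult_right: "transfer_comult C A m \<eta> X \<psi> \<delta> \<lhd>\<^bsub>T\<^esub> (X, \<psi>) =
    ((X \<odot> X, \<psi>\<^sub>2), (X \<odot> X, \<psi>\<^sub>2) \<odot>\<^bsub>T\<^esub> (X, \<psi>), \<delta> \<lhd> X)"
  unfolding comult_T using whisker_right_T[OF trX trXX \<delta>_hom] by (simp add: tensor_XX)

lemma comult_left: "(X, \<psi>) \<rhd>\<^bsub>T\<^esub> transfer_comult C A m \<eta> X \<psi> \<delta> =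
    ((X \<odot> X, \<psi>\<^sub>2), (X, \<psi>) \<odot>\<^bsub>T\<^esub> (X \<odot> X, \<psi>\<^sub>2), (\<psi> \<lhd> (X \<odot> X)) \<cdot> (X \<rhd> \<delta>))"
  unfolding comult_T using whisker_left_T[OF trX \<delta>_hom] X(1) by (simp add: tensor_XX tensor_in_Ob)

text \<open>The coalgebra axiom is an equation of triples in \<open>T\<close>; its last component,
  with both whiskerings evaluated, is an equation in \<open>C\<close>. The two counit lemmas below
  are obtained in the same way.\<close>

lemma coassoc: "(m \<lhd> (X \<odot> X \<odot> X)) \<cdot> (A \<rhd> (\<delta> \<lhd> X)) \<cdot> \<delta> =
    (m \<lhd> (X \<odot> X \<odot> X)) \<cdot> (A \<rhd> ((\<psi> \<lhd> (X \<odot> X)) \<cdot> (X \<rhd> \<delta>))) \<cdot> \<delta>"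
proof -
  have "(transfer_comult C A m \<eta> X \<psi> \<delta> \<lhd>\<^bsub>T\<^esub> (X, \<psi>)) \<cdot>\<^bsub>T\<^esub> transfer_comult C A m \<eta> X \<psi> \<delta> =
    ((X, \<psi>) \<rhd>\<^bsub>T\<^esub> transfer_comult C A m \<eta> X \<psi> \<delta>) \<cdot>\<^bsub>T\<^esub> transfer_comult C A m \<eta> X \<psi> \<delta>"
    using coalg by (simp add: coalgebra_def)
  then show ?thesis
    unfolding comult_right comult_left using X(1)
    by (simp add: comult_T tensorOb_T comp_T tensor_assoc_Ob)
qed

lemma counit_left: "(m \<lhd> X) \<cdot> (A \<rhd> (\<epsilon> \<lhd> X)) \<cdot> \<delta> = \<eta> \<lhd> X"
proof -
  have "(transfer_counit C A m \<eta> X \<psi> \<epsilon> \<lhd>\<^bsub>T\<^esub> (X, \<psi>)) \<cdot>\<^bsub>T\<^esub> transfer_comult C A m \<eta> X \<psi> \<delta> =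
     Id T (X, \<psi>)"
    using coalg by (simp add: coalgebra_def)
  then show ?thesis
    unfolding counit_T using X(1) whisker_right_T[OF trX transfer_unit \<epsilon>_hom]
      transfer_tensor_one(2)[OF trX]
    by (simp add: comult_T comp_T id_T unit_T)
qed

lemma counit_right: "(m \<lhd> X) \<cdot> (A \<rhd> (\<psi> \<cdot> (X \<rhd> \<epsilon>))) \<cdot> \<delta> = \<eta> \<lhd> X"
proof -
  have "((X, \<psi>) \<rhd>\<^bsub>T\<^esub> transfer_counit C A m \<eta> X \<psi> \<epsilon>) \<cdot>\<^bsub>T\<^esub> transfer_comult C A m \<eta> X \<psi> \<delta> =
     Id T (X, \<psi>)"
    using coalg by (simp add: coalgebra_def)
  then show ?thesis
    unfolding counit_T using X whisker_left_T[OF trX \<epsilon>_hom unit_in_Ob]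
      transfer_tensor_one(1)[OF trX]
    by (simp add: comult_T comp_T id_T unit_T whisker_unit)
qed

text \<open>The Frobenius structure expressed in \<open>C\<close>. The factors
  \<open>m \<lhd> \<one>\<close> are \<open>m\<close>; they are kept because composition in
  \<open>T\<close> with target the unit object produces them in this form.\<close>

definition frobenius_data where
  "frobenius_data t B \<longleftrightarrow> transfer_mor \<one> (Id C A) X \<psi> t \<and> transfer_mor (X \<odot> X) \<psi>\<^sub>2 \<one> (Id C A) B \<and>
     (m \<lhd> X) \<cdot> (A \<rhd> (\<psi> \<cdot> (X \<rhd> B))) \<cdot> (\<delta> \<lhd> X) =
       (m \<lhd> X) \<cdot> (A \<rhd> (B \<lhd> X)) \<cdot> ((\<psi> \<lhd> (X \<odot> X)) \<cdot> (X \<rhd> \<delta>)) \<and>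
     (m \<lhd> \<one>) \<cdot> (A \<rhd> B) \<cdot> (t \<lhd> X) = \<epsilon> \<and>
     (m \<lhd> \<one>) \<cdot> (A \<rhd> B) \<cdot> ((\<psi> \<lhd> X) \<cdot> (X \<rhd> t)) = \<epsilon>"

lemma XX_X: "(X \<odot> X, \<psi>\<^sub>2) \<odot>\<^bsub>T\<^esub> (X, \<psi>) = (X, \<psi>) \<odot>\<^bsub>T\<^esub> (X \<odot> X, \<psi>\<^sub>2)"
  using X A by (simp add: tensorOb_T \<psi>\<^sub>2_def mon)

text \<open>With its end points fixed, an arrow of \<open>T\<close> is determined by its last
  component, so quantifying over arrows \<open>t'\<close>, \<open>B'\<close> amounts to quantifying
  over \<open>t\<close>, \<open>B\<close>. The whiskering formulas then translate the
  equations.\<close>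

lemma frobenius_iff: "frobenius_coalgebra T (X, \<psi>) (transfer_comult C A m \<eta> X \<psi> \<delta>)
    (transfer_counit C A m \<eta> X \<psi> \<epsilon>) \<longleftrightarrow> (\<exists>t B. frobenius_data t B)"
proof -
  define P where "P t' B' \<longleftrightarrow>
      ((X, \<psi>) \<rhd>\<^bsub>T\<^esub> B') \<cdot>\<^bsub>T\<^esub> (transfer_comult C A m \<eta> X \<psi> \<delta> \<lhd>\<^bsub>T\<^esub> (X, \<psi>)) =
        (B' \<lhd>\<^bsub>T\<^esub> (X, \<psi>)) \<cdot>\<^bsub>T\<^esub> ((X, \<psi>) \<rhd>\<^bsub>T\<^esub> transfer_comult C A m \<eta> X \<psi> \<delta>) \<and>
      B' \<cdot>\<^bsub>T\<^esub> (t' \<lhd>\<^bsub>T\<^esub> (X, \<psi>)) = transfer_counit C A m \<eta> X \<psi> \<epsilon> \<and>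
      B' \<cdot>\<^bsub>T\<^esub> ((X, \<psi>) \<rhd>\<^bsub>T\<^esub> t') = transfer_counit C A m \<eta> X \<psi> \<epsilon>" for t' B'
  have key: "P t' B' \<longleftrightarrow> frobenius_data t B"
    if t': "t' = ((\<one>, Id C A), (X, \<psi>), t)" and t: "transfer_mor \<one> (Id C A) X \<psi> t"
      and B': "B' = ((X \<odot> X, \<psi>\<^sub>2), (\<one>, Id C A), B)" and B: "transfer_mor (X \<odot> X) \<psi>\<^sub>2 \<one> (Id C A) B"
    for t' B' t B
  proof -
    have 1: "t' \<lhd>\<^bsub>T\<^esub> (X, \<psi>) = ((X, \<psi>), (X \<odot> X, \<psi>\<^sub>2), t \<lhd> X)"
      unfolding t' using whisker_right_T[OF trX trX transfer_mor_hom[OF t]] transfer_tensor_one[OF trX]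
      by (simp add: tensor_XX unit_T)
    have 2: "(X, \<psi>) \<rhd>\<^bsub>T\<^esub> t' = ((X, \<psi>), (X \<odot> X, \<psi>\<^sub>2), (\<psi> \<lhd> X) \<cdot> (X \<rhd> t))"
      unfolding t' using whisker_left_T[OF trX transfer_mor_hom[OF t] X(1)] transfer_tensor_one[OF trX]
      by (simp add: tensor_XX unit_T)
    have 3: "B' \<lhd>\<^bsub>T\<^esub> (X, \<psi>) = ((X \<odot> X, \<psi>\<^sub>2) \<odot>\<^bsub>T\<^esub> (X, \<psi>), (X, \<psi>), B \<lhd> X)"
      unfolding B' using whisker_right_T[OF trX transfer_unit transfer_mor_hom[OF B]]
        transfer_tensor_one[OF trX] by (simp add: unit_T)
    have 4: "(X, \<psi>) \<rhd>\<^bsub>T\<^esub> B' = ((X, \<psi>) \<odot>\<^bsub>T\<^esub> (X \<odot> X, \<psi>\<^sub>2), (X, \<psi>), \<psi> \<cdot> (X \<rhd> B))"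
      unfolding B' using whisker_left_T[OF trX transfer_mor_hom[OF B] unit_in_Ob] X
        transfer_tensor_one[OF trX] by (simp add: unit_T whisker_unit)
    have 5: "B' \<cdot>\<^bsub>T\<^esub> (x, y, f) = (x, (\<one>, Id C A), (m \<lhd> \<one>) \<cdot> (A \<rhd> B) \<cdot> f)" for x y f
      unfolding B' by (rule comp_T)
    show ?thesis
      unfolding P_def 1 2 3 4 5 comult_left comult_right counit_T using t B
      by (auto simp: comp_T XX_X frobenius_data_def)
  qed
  have "frobenius_coalgebra T (X, \<psi>) (transfer_comult C A m \<eta> X \<psi> \<delta>)
      (transfer_counit C A m \<eta> X \<psi> \<epsilon>) \<longleftrightarrow>
    (\<exists>t' \<in> hom T (\<one>, Id C A) (X, \<psi>). \<exists>B' \<in> hom T (X \<odot> X, \<psi>\<^sub>2) (\<one>, Id C A). P t' B')"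
    using coalg by (simp add: frobenius_coalgebra_def P_def tensor_XX unit_T)
  also have "\<dots> \<longleftrightarrow> (\<exists>t B. transfer_mor \<one> (Id C A) X \<psi> t \<and> transfer_mor (X \<odot> X) \<psi>\<^sub>2 \<one> (Id C A) B \<and>
      P ((\<one>, Id C A), (X, \<psi>), t) ((X \<odot> X, \<psi>\<^sub>2), (\<one>, Id C A), B))"
    using trX trXX transfer_unit by (force simp: hom_T)
  also have "\<dots> \<longleftrightarrow> (\<exists>t B. frobenius_data t B)"
    using key[OF refl _ refl] by (auto simp: frobenius_data_def)
  finally show ?thesis .
qed

abbreviation "entwined \<equiv> entwined_module C A m \<eta> X \<psi> \<delta> \<epsilon>"

lemma act_\<delta>_hom: "module N \<mu> \<Longrightarrow> act N \<mu> (X \<odot> X) \<delta> \<in> hom C (N \<odot> X) (N \<odot> X \<odot> X)"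
  using act_hom[OF _ \<delta>_hom] X(1) tensor_in_Ob by simp

lemma act_\<epsilon>_hom: "module N \<mu> \<Longrightarrow> act N \<mu> \<one> \<epsilon> \<in> hom C (N \<odot> X) N"
  using act_hom[OF _ \<epsilon>_hom] unit_in_Ob unit_right_Ob module(1) by metis

text \<open>Coassociativity of the comonad given by tensoring with \<open>X\<close>: the action is
  applied to \<open>coassoc\<close>, with right whiskering kept at \<open>N\<close> and left
  whiskering turned into the action on \<open>NX\<close>. The two counit laws follow the same
  pattern.\<close>

lemma act_coassoc:
  assumes N: "module N \<mu>"
  shows "(act N \<mu> (X \<odot> X) \<delta> \<lhd> X) \<cdot> act N \<mu> (X \<odot> X) \<delta> =
    act (N \<odot> X) (act N \<mu> X \<psi>) (X \<odot> X) \<delta> \<cdot> act N \<mu> (X \<odot> X) \<delta>"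
proof -
  have XX: "X \<odot> X \<in> Ob C" "X \<odot> X \<odot> X \<in> Ob C" using X tensor_in_Ob by auto
  have h: "\<delta> \<lhd> X \<in> hom C (X \<odot> X) (A \<odot> X \<odot> X \<odot> X)"
    "(\<psi> \<lhd> (X \<odot> X)) \<cdot> (X \<rhd> \<delta>) \<in> hom C (X \<odot> X) (A \<odot> X \<odot> X \<odot> X)"
    using X A \<delta>_hom by (auto simp: hom_def mon)
  show ?thesis
    using arg_cong[OF coassoc, of "act N \<mu> (X \<odot> X \<odot> X)"]
      act_comp[OF N \<delta>_hom h(1) XX] act_comp[OF N \<delta>_hom h(2) XX]
      act_whisker[OF N \<delta>_hom XX(1) X(1)] act_tensor[OF N \<delta>_hom XX(1) X(1,2)] X(1)
    by (simp add: tensor_assoc_Ob)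
qed

lemma act_counit_left:
  assumes N: "module N \<mu>"
  shows "(act N \<mu> \<one> \<epsilon> \<lhd> X) \<cdot> act N \<mu> (X \<odot> X) \<delta> = Id C (N \<odot> X)"
proof -
  have XX: "X \<odot> X \<in> Ob C" using X tensor_in_Ob by auto
  have h: "\<epsilon> \<lhd> X \<in> hom C (X \<odot> X) (A \<odot> X)"
    using X A \<epsilon>_hom by (auto simp: hom_def mon)
  show ?thesis
    using arg_cong[OF counit_left, of "act N \<mu> X"] act_comp[OF N \<delta>_hom h XX X(1)] act_eta[OF N X(1)]
      act_whisker[OF N \<epsilon>_hom unit_in_Ob X(1)] X(1) by (simp add: unit_left_Ob)
qed

lemma act_counit_right:
  assumes N: "module N \<mu>"
  shows "act (N \<odot> X) (act N \<mu> X \<psi>) \<one> \<epsilon> \<cdot> act N \<mu> (X \<odot> X) \<delta> = Id C (N \<odot> X)"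
proof -
  have XX: "X \<odot> X \<in> Ob C" using X tensor_in_Ob by auto
  have h: "\<psi> \<cdot> (X \<rhd> \<epsilon>) \<in> hom C (X \<odot> X) (A \<odot> X)"
    using X A \<epsilon>_hom by (auto simp: hom_def mon)
  show ?thesis
    using arg_cong[OF counit_right, of "act N \<mu> X"] act_comp[OF N \<delta>_hom h XX X(1)] act_eta[OF N X(1)]
      act_tensor[OF N \<epsilon>_hom unit_in_Ob X(1,2)] X by (simp add: unit_right_Ob whisker_unit)
qed

text \<open>Read through \<open>act\<close>, the entwined module axioms say that
  \<open>\<rho>\<close> is a linear map from \<open>M\<close> to \<open>MX\<close> that is
  coassociative and counital, that is, a comodule structure over the comonad.\<close>

lemma entwined_iff:
  "entwined M \<mu> \<rho> \<longleftrightarrow> module M \<mu> \<and> linear M \<mu> (M \<odot> X) (act M \<mu> X \<psi>) \<rho> \<and>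
     (\<rho> \<lhd> X) \<cdot> \<rho> = act M \<mu> (X \<odot> X) \<delta> \<cdot> \<rho> \<and> act M \<mu> \<one> \<epsilon> \<cdot> \<rho> = Id C M"
proof -
  have "(\<mu> \<lhd> X) \<cdot> (M \<rhd> \<psi>) \<cdot> (\<rho> \<lhd> A) = act M \<mu> X \<psi> \<cdot> (\<rho> \<lhd> A)"
    "(\<mu> \<lhd> (X \<odot> X)) \<cdot> (M \<rhd> \<delta>) \<cdot> \<rho> = act M \<mu> (X \<odot> X) \<delta> \<cdot> \<rho>"
    "\<mu> \<cdot> (M \<rhd> \<epsilon>) \<cdot> \<rho> = act M \<mu> \<one> \<epsilon> \<cdot> \<rho>"
    if "module M \<mu>" "\<rho> \<in> hom C M (M \<odot> X)"
    using that(2) module(1-4)[OF that(1)] X A \<delta>_hom \<epsilon>_hom by (auto simp: hom_def mon act_def)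
  then show ?thesis
    by (auto simp: entwined_module_def)
qed

text \<open>The cofree comodule on \<open>N\<close>. Linearity of its coaction holds because
  \<open>\<delta>\<close> is a transfer morphism; the comodule axioms are \<open>act_coassoc\<close>
  and \<open>act_counit_right\<close>.\<close>

lemma entwined_cofree:
  assumes N: "module N \<mu>"
  shows "entwined (N \<odot> X) (act N \<mu> X \<psi>) (act N \<mu> (X \<odot> X) \<delta>)"
  using act_module[OF N trX] linear_act[OF N trX trXX \<delta>] act_coassoc[OF N] act_counit_right[OF N]
    act_module_tensor[OF N trX trX] X(1) module(1)[OF N]
  by (simp add: entwined_iff tensor_assoc_Ob \<psi>\<^sub>2_def)

section \<open>The cofree functor\<close>

lemma XX: "X \<odot> X \<in> Ob C" "X \<odot> X \<odot> X \<in> Ob C"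
  using X tensor_in_Ob by auto

section \<open>The Frobenius equations evaluated on a module\<close>

context
  fixes t B N \<mu>
  assumes t: "t \<in> hom C \<one> (A \<odot> X)" and B: "B \<in> hom C (X \<odot> X) (A \<odot> \<one>)" and N: "module N \<mu>"
begin

text \<open>Together with the next three lemmas this rewrites each composite in
  \<open>frobenius_data\<close> as a composite of actions: right whiskering stays at
  \<open>N\<close>, left whiskering passes to \<open>NX\<close>.\<close>

lemma act_frobenius_left:
  "act N \<mu> X ((m \<lhd> X) \<cdot> (A \<rhd> (\<psi> \<cdot> (X \<rhd> B))) \<cdot> (\<delta> \<lhd> X)) =
    act (N \<odot> X) (act N \<mu> X \<psi>) \<one> B \<cdot> (act N \<mu> (X \<odot> X) \<delta> \<lhd> X)"
proof -
  have h: "\<psi> \<cdot> (X \<rhd> B) \<in> hom C (X \<odot> X \<odot> X) (A \<odot> X)" "\<delta> \<lhd> X \<in> hom C (X \<odot> X) (A \<odot> X \<odot> X \<odot> X)"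
    using B \<delta>_hom X A by (auto simp: hom_def mon)
  show ?thesis
    using act_comp[OF N h(2,1) XX(2) X(1)] act_tensor[OF N B unit_in_Ob X(1,2)]
      act_whisker[OF N \<delta>_hom XX(1) X(1)] X by (simp add: tensor_assoc_Ob unit_right_Ob whisker_unit)
qed

lemma act_frobenius_right:
  "act N \<mu> X ((m \<lhd> X) \<cdot> (A \<rhd> (B \<lhd> X)) \<cdot> ((\<psi> \<lhd> (X \<odot> X)) \<cdot> (X \<rhd> \<delta>))) =
    (act N \<mu> \<one> B \<lhd> X) \<cdot> act (N \<odot> X) (act N \<mu> X \<psi>) (X \<odot> X) \<delta>"
proof -
  have h: "B \<lhd> X \<in> hom C (X \<odot> X \<odot> X) (A \<odot> X)"
    "(\<psi> \<lhd> (X \<odot> X)) \<cdot> (X \<rhd> \<delta>) \<in> hom C (X \<odot> X) (A \<odot> X \<odot> X \<odot> X)"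
    using B \<delta>_hom X A by (auto simp: hom_def mon)
  show ?thesis
    using act_comp[OF N h(2,1) XX(2) X(1)] act_tensor[OF N \<delta>_hom XX(1) X(1,2)]
      act_whisker[OF N B unit_in_Ob X(1)] X by (simp add: unit_left_Ob)
qed

lemma act_unit_left:
  "act N \<mu> \<one> ((m \<lhd> \<one>) \<cdot> (A \<rhd> B) \<cdot> (t \<lhd> X)) = act N \<mu> \<one> B \<cdot> (act N \<mu> X t \<lhd> X)"
proof -
  have h: "t \<lhd> X \<in> hom C X (A \<odot> X \<odot> X)"
    using t X A by (auto simp: hom_def mon)
  show ?thesis
    using act_comp[OF N h B XX(1) unit_in_Ob] act_whisker[OF N t X(1,1)] by simp
qed

lemma act_unit_right:
  "act N \<mu> \<one> ((m \<lhd> \<one>) \<cdot> (A \<rhd> B) \<cdot> ((\<psi> \<lhd> X) \<cdot> (X \<rhd> t))) =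
    act N \<mu> \<one> B \<cdot> act (N \<odot> X) (act N \<mu> X \<psi>) X t"
proof -
  have h: "(\<psi> \<lhd> X) \<cdot> (X \<rhd> t) \<in> hom C X (A \<odot> X \<odot> X)"
    using t X A by (auto simp: hom_def mon)
  show ?thesis
    using act_comp[OF N h B XX(1) unit_in_Ob] act_tensor[OF N t X(1,1,2)] by simp
qed

end

section \<open>The categories of modules and of entwined modules\<close>

abbreviation "D \<equiv> right_modules C A m \<eta>"
abbreviation "E \<equiv> entwined_modules C A m \<eta> X \<psi> \<delta> \<epsilon>"

abbreviation "entwined_map M \<mu> \<rho> M' \<mu>' \<rho>' f \<equiv> linear M \<mu> M' \<mu>' f \<and> (f \<lhd> X) \<cdot> \<rho> = \<rho>' \<cdot> f"

lemma hom_D: "z \<in> hom D (N, \<mu>) (N', \<mu>') \<longleftrightarrow>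
    (\<exists>f. z = ((N, \<mu>), (N', \<mu>'), f) \<and> module N \<mu> \<and> module N' \<mu>' \<and> linear N \<mu> N' \<mu>' f)"
  unfolding hom_def[of D] by (auto simp: right_modules_def)

lemma hom_E: "z \<in> hom E (M, \<mu>, \<rho>) (M', \<mu>', \<rho>') \<longleftrightarrow>
    (\<exists>f. z = ((M, \<mu>, \<rho>), (M', \<mu>', \<rho>'), f) \<and> entwined M \<mu> \<rho> \<and> entwined M' \<mu>' \<rho>' \<and>
       entwined_map M \<mu> \<rho> M' \<mu>' \<rho>' f)"
  unfolding hom_def[of E] by (auto simp: entwined_modules_def)

lemma Ob_D: "(N, \<mu>) \<in> Ob D \<longleftrightarrow> module N \<mu>"
  and comp_D: "(y', z, g) \<cdot>\<^bsub>D\<^esub> (x, y, f) = (x, z, g \<cdot> f)"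
  and id_D: "Id D (N, \<mu>) = ((N, \<mu>), (N, \<mu>), Id C N)"
  by (auto simp: right_modules_def)

lemma Ob_E: "(M, \<mu>, \<rho>) \<in> Ob E \<longleftrightarrow> entwined M \<mu> \<rho>"
  and comp_E: "(y', z, g) \<cdot>\<^bsub>E\<^esub> (x, y, f) = (x, z, g \<cdot> f)"
  and id_E: "Id E (M, \<mu>, \<rho>) = ((M, \<mu>, \<rho>), (M, \<mu>, \<rho>), Id C M)"
  by (auto simp: entwined_modules_def)

lemma entwinedD:
  assumes "entwined M \<mu> \<rho>"
  shows "module M \<mu>" "linear M \<mu> (M \<odot> X) (act M \<mu> X \<psi>) \<rho>"
    "(\<rho> \<lhd> X) \<cdot> \<rho> = act M \<mu> (X \<odot> X) \<delta> \<cdot> \<rho>" "act M \<mu> \<one> \<epsilon> \<cdot> \<rho> = Id C M"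
    "\<rho> \<in> Ar C" "Dom C \<rho> = M" "Cod C \<rho> = M \<odot> X"
  using assms by (auto simp: entwined_iff hom_def)

lemma entwined_map_comp:
  assumes f: "entwined_map M \<mu> \<rho> M' \<mu>' \<rho>' f" and g: "entwined_map M' \<mu>' \<rho>' M'' \<mu>'' \<rho>'' g"
    and M: "entwined M \<mu> \<rho>" "entwined M' \<mu>' \<rho>'" "entwined M'' \<mu>'' \<rho>''"
  shows "entwined_map M \<mu> \<rho> M'' \<mu>'' \<rho>'' (g \<cdot> f)"
proof -
  have t: "f \<in> Ar C" "Dom C f = M" "Cod C f = M'" "g \<in> Ar C" "Dom C g = M'" "Cod C g = M''"
    using f g by (auto simp: hom_def)
  note t = t X entwinedD(5-7)[OF M(1)] entwinedD(5-7)[OF M(2)] entwinedD(5-7)[OF M(3)]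
  have "((g \<cdot> f) \<lhd> X) \<cdot> \<rho> = (g \<lhd> X) \<cdot> ((f \<lhd> X) \<cdot> \<rho>)" using t by (simp add: mon)
  also have "\<dots> = ((g \<lhd> X) \<cdot> \<rho>') \<cdot> f" using f t by (simp add: mon)
  also have "\<dots> = (\<rho>'' \<cdot> g) \<cdot> f" using g by simp
  also have "\<dots> = \<rho>'' \<cdot> (g \<cdot> f)" using t by (simp add: mon)
  finally show ?thesis
    using linear_comp[OF conjunct1[OF f] conjunct1[OF g]] M entwinedD(1) by blast
qed

lemma entwined_map_id:
  assumes "entwined M \<mu> \<rho>"
  shows "entwined_map M \<mu> \<rho> M \<mu> \<rho> (Id C M)"
  using linear_id[OF entwinedD(1)[OF assms]] entwinedD(5-7)[OF assms]
    module(1)[OF entwinedD(1)[OF assms]] X by (simp add: mon)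

lemma category_D: "category D"
proof
  fix X assume "X \<in> Ob D"
  then show "Id D X \<in> hom D X X"
    using linear_id by (cases X) (auto simp: hom_D Ob_D id_D)
next
  fix X Y Z f g assume "f \<in> hom D X Y" "g \<in> hom D Y Z"
  moreover obtain N \<mu> N' \<mu>' N'' \<mu>'' where [simp]: "X = (N, \<mu>)" "Y = (N', \<mu>')" "Z = (N'', \<mu>'')"
    by (cases X, cases Y, cases Z) auto
  ultimately obtain f' g' where "f = (X, Y, f')" "g = (Y, Z, g')"
    and l: "linear N \<mu> N' \<mu>' f'" "linear N' \<mu>' N'' \<mu>'' g'"
    and o: "module N \<mu>" "module N' \<mu>'" "module N'' \<mu>''"
    by (auto simp: hom_D)
  then show "g \<cdot>\<^bsub>D\<^esub> f \<in> hom D X Z"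
    using linear_comp[OF l o] by (simp add: comp_D hom_D)
next
  fix W X Y Z f g h assume "f \<in> hom D W X" "g \<in> hom D X Y" "h \<in> hom D Y Z"
  then show "(h \<cdot>\<^bsub>D\<^esub> g) \<cdot>\<^bsub>D\<^esub> f = h \<cdot>\<^bsub>D\<^esub> (g \<cdot>\<^bsub>D\<^esub> f)"
    by (cases W; cases X; cases Y; cases Z) (auto simp: hom_D comp_D intro: comp_assoc)
next
  fix X Y f assume "f \<in> hom D X Y"
  then show "f \<cdot>\<^bsub>D\<^esub> Id D X = f" "Id D Y \<cdot>\<^bsub>D\<^esub> f = f"
    by (cases X; cases Y; auto simp: hom_D comp_D id_D intro: comp_id_left comp_id_right)+
qed (auto simp: right_modules_def)

lemma category_E: "category E"
proof
  fix X assume "X \<in> Ob E"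
  then show "Id E X \<in> hom E X X"
    using entwined_map_id by (cases X) (auto simp: hom_E Ob_E id_E)
next
  fix P Q R f g assume "f \<in> hom E P Q" "g \<in> hom E Q R"
  moreover obtain M \<mu> \<rho> M' \<mu>' \<rho>' M'' \<mu>'' \<rho>''
    where [simp]: "P = (M, \<mu>, \<rho>)" "Q = (M', \<mu>', \<rho>')" "R = (M'', \<mu>'', \<rho>'')"
    by (cases P, cases Q, cases R) auto
  ultimately obtain f' g' where "f = (P, Q, f')" "g = (Q, R, g')"
    and l: "entwined_map M \<mu> \<rho> M' \<mu>' \<rho>' f'" "entwined_map M' \<mu>' \<rho>' M'' \<mu>'' \<rho>'' g'"
    and o: "entwined M \<mu> \<rho>" "entwined M' \<mu>' \<rho>'" "entwined M'' \<mu>'' \<rho>''"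
    by (auto simp: hom_E)
  then show "g \<cdot>\<^bsub>E\<^esub> f \<in> hom E P R"
    using entwined_map_comp[OF l o] by (simp add: comp_E hom_E)
next
  fix W X Y Z f g h assume "f \<in> hom E W X" "g \<in> hom E X Y" "h \<in> hom E Y Z"
  then show "(h \<cdot>\<^bsub>E\<^esub> g) \<cdot>\<^bsub>E\<^esub> f = h \<cdot>\<^bsub>E\<^esub> (g \<cdot>\<^bsub>E\<^esub> f)"
    by (cases W; cases X; cases Y; cases Z) (auto simp: hom_E comp_E intro: comp_assoc)
next
  fix X Y f assume "f \<in> hom E X Y"
  then show "f \<cdot>\<^bsub>E\<^esub> Id E X = f" "Id E Y \<cdot>\<^bsub>E\<^esub> f = f"
    by (cases X; cases Y; auto simp: hom_E comp_E id_E intro: comp_id_left comp_id_right)+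
qed (auto simp: entwined_modules_def)

section \<open>The forgetful functor and its cofree right adjoint\<close>

definition cofree_ob where
  "cofree_ob = (\<lambda>(N, \<mu>). (N \<odot> X, act N \<mu> X \<psi>, act N \<mu> (X \<odot> X) \<delta>))"

definition cofree_ar where
  "cofree_ar = (\<lambda>(x, y, f). (cofree_ob x, cofree_ob y, f \<lhd> X))"

lemma cofree_simps:
  "cofree_ob (N, \<mu>) = (N \<odot> X, act N \<mu> X \<psi>, act N \<mu> (X \<odot> X) \<delta>)"
  "cofree_ar (x, y, f) = (cofree_ob x, cofree_ob y, f \<lhd> X)"
  by (auto simp: cofree_ob_def cofree_ar_def)

lemma functor_forgetful: "category_functor E D forgetful_ob forgetful_ar"
proof (rule category_functor.intro[OF category_E category_D], unfold_locales)
  fix X assume "X \<in> Ob E"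
  then show "forgetful_ob X \<in> Ob D" "forgetful_ar (Id E X) = Id D (forgetful_ob X)"
    by (cases X; auto simp: Ob_E Ob_D id_E id_D entwinedD(1))+
next
  fix X Y f assume "f \<in> hom E X Y"
  then show "forgetful_ar f \<in> hom D (forgetful_ob X) (forgetful_ob Y)"
    by (cases X; cases Y) (auto simp: hom_E hom_D entwinedD(1))
next
  fix X Y Z f g assume "f \<in> hom E X Y" "g \<in> hom E Y Z"
  then show "forgetful_ar (g \<cdot>\<^bsub>E\<^esub> f) = forgetful_ar g \<cdot>\<^bsub>D\<^esub> forgetful_ar f"
    by (cases X; cases Y; cases Z) (auto simp: hom_E comp_E comp_D)
qed

text \<open>Colinearity of \<open>h \<lhd> X\<close> is naturality of the action of
  \<open>\<delta>\<close> along \<open>h\<close>.\<close>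

lemma entwined_map_cofree:
  assumes N: "module N \<mu>" "module N' \<mu>'" and h: "linear N \<mu> N' \<mu>' h"
  shows "entwined_map (N \<odot> X) (act N \<mu> X \<psi>) (act N \<mu> (X \<odot> X) \<delta>)
     (N' \<odot> X) (act N' \<mu>' X \<psi>) (act N' \<mu>' (X \<odot> X) \<delta>) (h \<lhd> X)"
proof -
  have "h \<in> Ar C" using h by (simp add: hom_def)
  then show ?thesis
    using linear_whisker[OF N h trX] act_natural[OF N h \<delta>_hom XX(1)] X(1)
    by (simp add: whisker_whisker)
qed

lemma functor_cofree: "category_functor D E cofree_ob cofree_ar"
proof (rule category_functor.intro[OF category_D category_E], unfold_locales)
  fix N assume "N \<in> Ob D"
  then show "cofree_ob N \<in> Ob E" "cofree_ar (Id D N) = Id E (cofree_ob N)"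
    using entwined_cofree module(1) X(1)
    by (cases N; auto simp: Ob_E Ob_D id_E id_D cofree_simps whisker_id)+
next
  fix M N f assume "f \<in> hom D M N"
  then show "cofree_ar f \<in> hom E (cofree_ob M) (cofree_ob N)"
    using entwined_map_cofree entwined_cofree
    by (cases M; cases N) (auto simp: hom_E hom_D cofree_simps)
next
  fix K M N f g assume "f \<in> hom D K M" "g \<in> hom D M N"
  then show "cofree_ar (g \<cdot>\<^bsub>D\<^esub> f) = cofree_ar g \<cdot>\<^bsub>E\<^esub> cofree_ar f"
    using X(1) by (cases K; cases M; cases N)
      (auto simp: hom_D comp_E comp_D cofree_simps hom_def[of C] whisker_comp)
qed

lemma linear_counit: "module N \<mu> \<Longrightarrow> linear (N \<odot> X) (act N \<mu> X \<psi>) N \<mu> (act N \<mu> \<one> \<epsilon>)"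
  using linear_act[OF _ trX transfer_unit \<epsilon>] act_module_one unit_right_Ob module(1) by metis

text \<open>The standard adjunction of a comonad: the unit at an entwined module is its coaction,
  the counit at \<open>N\<close> is the action of \<open>\<epsilon>\<close>. One triangle identity
  is the counit axiom of the entwined module, the other is \<open>act_counit_left\<close>.\<close>

lemma forgetful_left_adjoint: "left_adjoint E D forgetful_ob forgetful_ar cofree_ob cofree_ar"
proof -
  define u :: "'o \<times> 'm \<times> 'm \<Rightarrow> _" where "u = (\<lambda>(M, \<mu>, \<rho>). ((M, \<mu>, \<rho>), cofree_ob (M, \<mu>), \<rho>))"
  define c where "c = (\<lambda>(N, \<mu>). (forgetful_ob (cofree_ob (N, \<mu>)), (N, \<mu>), act N \<mu> \<one> \<epsilon>))"
  have us: "u (M, \<mu>, \<rho>) = ((M, \<mu>, \<rho>), cofree_ob (M, \<mu>), \<rho>)" for M \<mu> \<rho> by (simp add: u_def)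
  have cs: "c (N, \<mu>) = (forgetful_ob (cofree_ob (N, \<mu>)), (N, \<mu>), act N \<mu> \<one> \<epsilon>)" for N \<mu> by (simp add: c_def)
  have "natural_transformation E E (\<lambda>X. X) (\<lambda>f. f) (\<lambda>X. cofree_ob (forgetful_ob X))
      (\<lambda>f. cofree_ar (forgetful_ar f)) u"
    unfolding natural_transformation_def
  proof (intro conjI ballI)
    fix P assume "P \<in> Ob E"
    then show "u P \<in> hom E P (cofree_ob (forgetful_ob P))"
      using entwinedD entwined_cofree by (cases P) (auto simp: Ob_E us hom_E cofree_simps)
  next
    fix P Q f assume "f \<in> hom E P Q"
    then show "u Q \<cdot>\<^bsub>E\<^esub> f = cofree_ar (forgetful_ar f) \<cdot>\<^bsub>E\<^esub> u P"
      by (cases P; cases Q) (auto simp: us hom_E comp_E cofree_simps)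
  qed
  moreover have "natural_transformation D D (\<lambda>Y. forgetful_ob (cofree_ob Y))
      (\<lambda>f. forgetful_ar (cofree_ar f)) (\<lambda>Y. Y) (\<lambda>f. f) c"
    unfolding natural_transformation_def
  proof (intro conjI ballI)
    fix P assume "P \<in> Ob D"
    then show "c P \<in> hom D (forgetful_ob (cofree_ob P)) P"
      using act_module[OF _ trX] linear_counit by (cases P) (auto simp: Ob_D cs hom_D cofree_simps)
  next
    fix P Q f assume f: "f \<in> hom D P Q"
    obtain N \<mu> N' \<mu>' where PQ: "P = (N, \<mu>)" "Q = (N', \<mu>')" by (cases P, cases Q) auto
    with f obtain h where h: "f = ((N, \<mu>), (N', \<mu>'), h)" "module N \<mu>" "module N' \<mu>'"
      "linear N \<mu> N' \<mu>' h" by (auto simp: hom_D)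
    have "h \<in> Ar C" using h by (simp add: hom_def)
    then show "c Q \<cdot>\<^bsub>D\<^esub> forgetful_ar (cofree_ar f) = f \<cdot>\<^bsub>D\<^esub> c P"
      using act_natural[OF h(2-4) \<epsilon>_hom unit_in_Ob]
      by (simp add: PQ h cs comp_D cofree_simps whisker_unit)
  qed
  moreover have "\<forall>P\<in>Ob E. c (forgetful_ob P) \<cdot>\<^bsub>D\<^esub> forgetful_ar (u P) = Id D (forgetful_ob P)"
    using entwinedD by (auto simp: Ob_E us cs comp_D cofree_simps id_D)
  moreover have "\<forall>P\<in>Ob D. cofree_ar (c P) \<cdot>\<^bsub>E\<^esub> u (cofree_ob P) = Id E (cofree_ob P)"
    using act_counit_left by (auto simp: Ob_D us cs comp_E cofree_simps id_E)
  ultimately show ?thesis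
    using functor_forgetful functor_cofree unfolding left_adjoint_def by blast
qed

text \<open>Whatever functor witnesses the Frobenius property, \<open>left_adjoint_transport\<close>
  carries its second adjunction over to the cofree functor.\<close>

lemma frobenius_functor_iff:
  "frobenius_functor E D forgetful_ob forgetful_ar \<longleftrightarrow>
    left_adjoint D E cofree_ob cofree_ar forgetful_ob forgetful_ar"
  unfolding frobenius_functor_def
  using forgetful_left_adjoint functor_forgetful left_adjoint_transport by blast

section \<open>From Frobenius data to the second adjunction\<close>

lemma cofree_left_adjoint:
  assumes "frobenius_data t B"
  shows "left_adjoint D E cofree_ob cofree_ar forgetful_ob forgetful_ar"
proof -
  have t: "transfer_mor \<one> (Id C A) X \<psi> t" and B: "transfer_mor (X \<odot> X) \<psi>\<^sub>2 \<one> (Id C A) B"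
    and frob: "(m \<lhd> X) \<cdot> (A \<rhd> (\<psi> \<cdot> (X \<rhd> B))) \<cdot> (\<delta> \<lhd> X) =
       (m \<lhd> X) \<cdot> (A \<rhd> (B \<lhd> X)) \<cdot> ((\<psi> \<lhd> (X \<odot> X)) \<cdot> (X \<rhd> \<delta>))"
    and tl: "(m \<lhd> \<one>) \<cdot> (A \<rhd> B) \<cdot> (t \<lhd> X) = \<epsilon>"
    and tr: "(m \<lhd> \<one>) \<cdot> (A \<rhd> B) \<cdot> ((\<psi> \<lhd> X) \<cdot> (X \<rhd> t)) = \<epsilon>"
    using assms by (auto simp: frobenius_data_def)
  note th = transfer_mor_hom[OF t] and Bh = transfer_mor_hom[OF B]
  define c0 where "c0 M \<mu> \<rho> = act M \<mu> \<one> B \<cdot> (\<rho> \<lhd> X)" for M \<mu> \<rho>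
  have Bhom: "act N \<mu> \<one> B \<in> hom C (N \<odot> X \<odot> X) N" if "module N \<mu>" for N \<mu>
    using act_hom[OF that Bh unit_in_Ob] unit_right_Ob module(1)[OF that] by simp
  have thom: "act N \<mu> X t \<in> hom C N (N \<odot> X)" if "module N \<mu>" for N \<mu>
    using act_hom[OF that th X(1)] unit_right_Ob module(1)[OF that] by simp
  have tlin: "linear N \<mu> (N \<odot> X) (act N \<mu> X \<psi>) (act N \<mu> X t)" if N: "module N \<mu>" for N \<mu>
    using linear_act[OF N transfer_unit trX t] act_module_one[OF N] unit_right_Ob module(1)[OF N]
    by simp
  have tnat: "(h \<lhd> X) \<cdot> act N \<mu> X t = act N' \<mu>' X t \<cdot> h"
    if "module N \<mu>" "module N' \<mu>'" "linear N \<mu> N' \<mu>' h" for N \<mu> N' \<mu>' h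
    using act_natural[OF that th X(1)] that(3) by (simp add: whisker_unit hom_def)
  have Bnat: "h \<cdot> act N \<mu> \<one> B = act N' \<mu>' \<one> B \<cdot> (h \<lhd> (X \<odot> X))"
    if "module N \<mu>" "module N' \<mu>'" "linear N \<mu> N' \<mu>' h" for N \<mu> N' \<mu>' h
    using act_natural[OF that Bh unit_in_Ob] that(3) by (simp add: whisker_unit hom_def)
  \<comment> \<open>Linearity is inherited from \<open>\<rho> \<lhd> X\<close> and the action of
    \<open>B\<close>. For colinearity, naturality of \<open>B\<close> along \<open>\<rho>\<close>
    and coassociativity of \<open>\<rho>\<close> create a \<open>\<delta>\<close> below
    \<open>B\<close>; the Frobenius law moves it to the other side, and naturality of
    \<open>\<delta>\<close> along \<open>\<rho>\<close> restores \<open>c0\<close>.\<close>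
  have c0_entwined_map: "entwined_map (M \<odot> X) (act M \<mu> X \<psi>) (act M \<mu> (X \<odot> X) \<delta>) M \<mu> \<rho> (c0 M \<mu> \<rho>)"
    if e: "entwined M \<mu> \<rho>" for M \<mu> \<rho>
  proof -
    note M = entwinedD(1)[OF e] and \<rho>l = entwinedD(2)[OF e]
    note MX = act_module[OF M trX] and MXX = act_module[OF M trXX]
    have "linear (M \<odot> X) (act M \<mu> X \<psi>) (M \<odot> X \<odot> X) (act M \<mu> (X \<odot> X) \<psi>\<^sub>2) (\<rho> \<lhd> X)"
      using linear_whisker[OF M MX \<rho>l trX] act_module_tensor[OF M trX trX] module(1)[OF M] X(1)
      by (simp add: tensor_assoc_Ob \<psi>\<^sub>2_def)
    moreover have "linear (M \<odot> X \<odot> X) (act M \<mu> (X \<odot> X) \<psi>\<^sub>2) M \<mu> (act M \<mu> \<one> B)"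
      using linear_act[OF M trXX transfer_unit B] act_module_one[OF M] unit_right_Ob module(1)[OF M]
      by simp
    ultimately have l: "linear (M \<odot> X) (act M \<mu> X \<psi>) M \<mu> (c0 M \<mu> \<rho>)"
      unfolding c0_def using linear_comp M MX MXX by blast
    note ty = entwinedD(5-7)[OF e] X module(1)[OF M] Bhom[OF M, unfolded hom_def]
      Bhom[OF MX, unfolded hom_def] act_\<delta>_hom[OF M, unfolded hom_def] act_\<delta>_hom[OF MX, unfolded hom_def]
    have 2: "(\<rho> \<lhd> (X \<odot> X)) \<cdot> (\<rho> \<lhd> X) = (act M \<mu> (X \<odot> X) \<delta> \<lhd> X) \<cdot> (\<rho> \<lhd> X)"
      using arg_cong[OF entwinedD(3)[OF e], of "\<lambda>x. x \<lhd> X"] ty by (simp add: mon)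
    have 3: "act (M \<odot> X) (act M \<mu> X \<psi>) \<one> B \<cdot> (act M \<mu> (X \<odot> X) \<delta> \<lhd> X) =
        (act M \<mu> \<one> B \<lhd> X) \<cdot> act (M \<odot> X) (act M \<mu> X \<psi>) (X \<odot> X) \<delta>"
      using act_frobenius_left[OF th Bh M] act_frobenius_right[OF th Bh M] frob by simp
    have 4: "act (M \<odot> X) (act M \<mu> X \<psi>) (X \<odot> X) \<delta> \<cdot> (\<rho> \<lhd> X) = (\<rho> \<lhd> (X \<odot> X)) \<cdot> act M \<mu> (X \<odot> X) \<delta>"
      using act_natural[OF M MX \<rho>l \<delta>_hom XX(1)] by simp
    have "\<rho> \<cdot> c0 M \<mu> \<rho> = (\<rho> \<cdot> act M \<mu> \<one> B) \<cdot> (\<rho> \<lhd> X)"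
      using ty by (simp add: mon c0_def)
    also have "\<dots> = act (M \<odot> X) (act M \<mu> X \<psi>) \<one> B \<cdot> ((\<rho> \<lhd> (X \<odot> X)) \<cdot> (\<rho> \<lhd> X))"
      unfolding Bnat[OF M MX \<rho>l] using ty by (simp add: mon)
    also have "\<dots> = (act (M \<odot> X) (act M \<mu> X \<psi>) \<one> B \<cdot> (act M \<mu> (X \<odot> X) \<delta> \<lhd> X)) \<cdot> (\<rho> \<lhd> X)"
      unfolding 2 using ty by (simp add: mon)
    also have "\<dots> = (act M \<mu> \<one> B \<lhd> X) \<cdot> (act (M \<odot> X) (act M \<mu> X \<psi>) (X \<odot> X) \<delta> \<cdot> (\<rho> \<lhd> X))"
      unfolding 3 using ty by (simp add: mon)
    also have "\<dots> = (c0 M \<mu> \<rho> \<lhd> X) \<cdot> act M \<mu> (X \<odot> X) \<delta>"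
      unfolding 4 using ty by (simp add: mon c0_def)
    finally show ?thesis using l by simp
  qed
  have c0_nat: "c0 M' \<mu>' \<rho>' \<cdot> (f \<lhd> X) = f \<cdot> c0 M \<mu> \<rho>"
    if e: "entwined M \<mu> \<rho>" "entwined M' \<mu>' \<rho>'" and f: "entwined_map M \<mu> \<rho> M' \<mu>' \<rho>' f"
    for M \<mu> \<rho> M' \<mu>' \<rho>' f
  proof -
    note M = entwinedD(1)[OF e(1)] and M' = entwinedD(1)[OF e(2)]
    have f': "f \<in> Ar C" "Dom C f = M" "Cod C f = M'" using f by (auto simp: hom_def)
    note ty = f' entwinedD(5-7)[OF e(1)] entwinedD(5-7)[OF e(2)] X module(1)[OF M] module(1)[OF M']
      Bhom[OF M, unfolded hom_def] Bhom[OF M', unfolded hom_def]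
    have 1: "(\<rho>' \<lhd> X) \<cdot> (f \<lhd> X) = (f \<lhd> (X \<odot> X)) \<cdot> (\<rho> \<lhd> X)"
      using arg_cong[OF conjunct2[OF f], of "\<lambda>x. x \<lhd> X"] ty by (simp add: mon)
    have "f \<cdot> c0 M \<mu> \<rho> = (f \<cdot> act M \<mu> \<one> B) \<cdot> (\<rho> \<lhd> X)"
      using ty by (simp add: mon c0_def)
    also have "\<dots> = act M' \<mu>' \<one> B \<cdot> ((f \<lhd> (X \<odot> X)) \<cdot> (\<rho> \<lhd> X))"
      unfolding Bnat[OF M M' conjunct1[OF f]] using ty by (simp add: mon)
    also have "\<dots> = c0 M' \<mu>' \<rho>' \<cdot> (f \<lhd> X)"
      unfolding 1[symmetric] using ty by (simp add: mon c0_def)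
    finally show ?thesis by simp
  qed
  \<comment> \<open>The Frobenius law rewrites the counit at the cofree module so that
    \<open>\<delta>\<close> acts first. Naturality of \<open>\<delta>\<close> along the action of
    \<open>t\<close> then brings \<open>t\<close> next to \<open>B\<close>; left normalisation turns
    the pair into \<open>\<epsilon>\<close>, and a counit law remains.\<close>
  have triangle1: "c0 (N \<odot> X) (act N \<mu> X \<psi>) (act N \<mu> (X \<odot> X) \<delta>) \<cdot> (act N \<mu> X t \<lhd> X) = Id C (N \<odot> X)"
    if N: "module N \<mu>" for N \<mu>
  proof -
    note NX = act_module[OF N trX]
    note ty = X module(1)[OF N] Bhom[OF N, unfolded hom_def] thom[OF N, unfolded hom_def]
      Bhom[OF NX, unfolded hom_def] act_\<delta>_hom[OF N, unfolded hom_def] act_\<delta>_hom[OF NX, unfolded hom_def]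
    have 1: "act (N \<odot> X) (act N \<mu> X \<psi>) \<one> B \<cdot> (act N \<mu> (X \<odot> X) \<delta> \<lhd> X) =
        (act N \<mu> \<one> B \<lhd> X) \<cdot> act (N \<odot> X) (act N \<mu> X \<psi>) (X \<odot> X) \<delta>"
      using act_frobenius_left[OF th Bh N] act_frobenius_right[OF th Bh N] frob by simp
    have 2: "act (N \<odot> X) (act N \<mu> X \<psi>) (X \<odot> X) \<delta> \<cdot> (act N \<mu> X t \<lhd> X) =
        (act N \<mu> X t \<lhd> (X \<odot> X)) \<cdot> act N \<mu> (X \<odot> X) \<delta>"
      using act_natural[OF N NX tlin[OF N] \<delta>_hom XX(1)] by simp
    have 3: "(act N \<mu> \<one> B \<lhd> X) \<cdot> (act N \<mu> X t \<lhd> (X \<odot> X)) = act N \<mu> \<one> \<epsilon> \<lhd> X"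
      using arg_cong[OF act_unit_left[OF th Bh N], of "\<lambda>x. x \<lhd> X"] ty unfolding tl by (simp add: mon)
    have "c0 (N \<odot> X) (act N \<mu> X \<psi>) (act N \<mu> (X \<odot> X) \<delta>) \<cdot> (act N \<mu> X t \<lhd> X) =
        (act N \<mu> \<one> B \<lhd> X) \<cdot> (act (N \<odot> X) (act N \<mu> X \<psi>) (X \<odot> X) \<delta> \<cdot> (act N \<mu> X t \<lhd> X))"
      unfolding c0_def 1 using ty by (simp add: mon)
    also have "\<dots> = ((act N \<mu> \<one> B \<lhd> X) \<cdot> (act N \<mu> X t \<lhd> (X \<odot> X))) \<cdot> act N \<mu> (X \<odot> X) \<delta>"
      unfolding 2 using ty by (simp add: mon)
    finally show ?thesis unfolding 3 using act_counit_left[OF N] by simp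
  qed
  \<comment> \<open>Naturality of the action of \<open>t\<close> along the linear map
    \<open>\<rho>\<close> puts \<open>\<rho>\<close> first. Right normalisation then leaves the
    counit axiom of \<open>M\<close>.\<close>
  have triangle2: "c0 M \<mu> \<rho> \<cdot> act M \<mu> X t = Id C M" if e: "entwined M \<mu> \<rho>" for M \<mu> \<rho>
  proof -
    note M = entwinedD(1)[OF e] and \<rho>l = entwinedD(2)[OF e]
    note MX = act_module[OF M trX]
    note ty = entwinedD(5-7)[OF e] X module(1)[OF M] Bhom[OF M, unfolded hom_def]
      thom[OF M, unfolded hom_def] thom[OF MX, unfolded hom_def]
    have "c0 M \<mu> \<rho> \<cdot> act M \<mu> X t = act M \<mu> \<one> B \<cdot> ((\<rho> \<lhd> X) \<cdot> act M \<mu> X t)"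
      using ty by (simp add: mon c0_def)
    also have "\<dots> = (act M \<mu> \<one> B \<cdot> act (M \<odot> X) (act M \<mu> X \<psi>) X t) \<cdot> \<rho>"
      unfolding tnat[OF M MX \<rho>l] using ty by (simp add: mon)
    finally show ?thesis
      using act_unit_right[OF th Bh M] entwinedD(4)[OF e] unfolding tr by simp
  qed
  define u where "u = (\<lambda>(N, \<mu>). ((N, \<mu>), forgetful_ob (cofree_ob (N, \<mu>)), act N \<mu> X t))"
  define c where "c = (\<lambda>(M, \<mu>, \<rho>). (cofree_ob (M, \<mu>), (M, \<mu>, \<rho>), c0 M \<mu> \<rho>))"
  have us: "u (N, \<mu>) = ((N, \<mu>), forgetful_ob (cofree_ob (N, \<mu>)), act N \<mu> X t)" for N \<mu> by (simp add: u_def)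
  have cs: "c (M, \<mu>, \<rho>) = (cofree_ob (M, \<mu>), (M, \<mu>, \<rho>), c0 M \<mu> \<rho>)" for M \<mu> \<rho> by (simp add: c_def)
  have "natural_transformation D D (\<lambda>X. X) (\<lambda>f. f) (\<lambda>X. forgetful_ob (cofree_ob X))
      (\<lambda>f. forgetful_ar (cofree_ar f)) u"
    unfolding natural_transformation_def
  proof (intro conjI ballI)
    fix P assume "P \<in> Ob D"
    then show "u P \<in> hom D P (forgetful_ob (cofree_ob P))"
      using act_module[OF _ trX] tlin by (cases P) (auto simp: Ob_D us hom_D cofree_simps)
  next
    fix P Q f assume f: "f \<in> hom D P Q"
    then show "u Q \<cdot>\<^bsub>D\<^esub> f = forgetful_ar (cofree_ar f) \<cdot>\<^bsub>D\<^esub> u P"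
      using tnat by (cases P; cases Q) (auto simp: us hom_D comp_D cofree_simps)
  qed
  moreover have "natural_transformation E E (\<lambda>Y. cofree_ob (forgetful_ob Y))
      (\<lambda>f. cofree_ar (forgetful_ar f)) (\<lambda>Y. Y) (\<lambda>f. f) c"
    unfolding natural_transformation_def
  proof (intro conjI ballI)
    fix P assume "P \<in> Ob E"
    then show "c P \<in> hom E (cofree_ob (forgetful_ob P)) P"
      using entwined_cofree entwinedD(1) c0_entwined_map by (cases P) (auto simp: Ob_E cs hom_E cofree_simps)
  next
    fix P Q f assume f: "f \<in> hom E P Q"
    then show "c Q \<cdot>\<^bsub>E\<^esub> cofree_ar (forgetful_ar f) = f \<cdot>\<^bsub>E\<^esub> c P"
      using c0_nat by (cases P; cases Q) (auto simp: cs hom_E comp_E cofree_simps)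
  qed
  moreover have "\<forall>P\<in>Ob D. c (cofree_ob P) \<cdot>\<^bsub>E\<^esub> cofree_ar (u P) = Id E (cofree_ob P)"
    using triangle1 by (auto simp: Ob_D us cs comp_E cofree_simps id_E)
  moreover have "\<forall>P\<in>Ob E. forgetful_ar (c P) \<cdot>\<^bsub>D\<^esub> u (forgetful_ob P) = Id D (forgetful_ob P)"
    using triangle2 by (auto simp: Ob_E us cs comp_D cofree_simps id_D)
  ultimately show ?thesis
    using functor_forgetful functor_cofree unfolding left_adjoint_def by blast
qed

end

section \<open>From an adjunction to Frobenius data\<close>

context monoidal_algebra
begin

text \<open>By associativity, left multiplication by a point of \<open>A\<close> commutes with right
  multiplication. These maps test naturality in the \<open>A\<close> factor.\<close>

lemma linear_left_mult:
  assumes h: "h \<in> hom C \<one> A"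
  shows "linear A m A m (m \<cdot> (h \<lhd> A))"
proof -
  have h': "h \<in> Ar C" "Dom C h = \<one>" "Cod C h = A" using h by (auto simp: hom_def)
  have m: "m \<in> hom C (A \<odot> A) A" using A by (simp add: hom_def)
  note ty = h' A
  have 1: "(h \<lhd> A) \<cdot> m = (A \<rhd> m) \<cdot> (h \<lhd> (A \<odot> A))"
    using exchange[OF h m] ty by (simp add: mon)
  have "(m \<cdot> (h \<lhd> A)) \<cdot> m = (m \<cdot> (A \<rhd> m)) \<cdot> (h \<lhd> (A \<odot> A))"
    using 1 ty by (simp add: mon)
  also have "\<dots> = m \<cdot> ((m \<cdot> (h \<lhd> A)) \<lhd> A)"
    unfolding m_assoc[symmetric] using ty by (simp add: mon)
  finally show ?thesis using ty by (simp add: mon hom_def)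
qed

text \<open>The multiplication axiom of \<open>\<zeta>\<close> is exactly what linearity requires
  here. These maps compare the component of a natural family at \<open>A\<close> with that at
  \<open>AZ\<close>.\<close>

lemma linear_transfer:
  assumes Z: "transfer Z \<zeta>" and h: "h \<in> hom C \<one> Z"
  shows "linear A m (A \<odot> Z) (act A m Z \<zeta>) (\<zeta> \<cdot> (h \<lhd> A))"
proof -
  have h': "h \<in> Ar C" "Dom C h = \<one>" "Cod C h = Z" using h by (auto simp: hom_def)
  have m: "m \<in> hom C (A \<odot> A) A" using A by (simp add: hom_def)
  note z = transfer[OF Z]
  note ty = h' A z(1,3-5)
  have 1: "(h \<lhd> A) \<cdot> m = (Z \<rhd> m) \<cdot> (h \<lhd> (A \<odot> A))"
    using exchange[OF h m] ty by (simp add: mon)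
  have "(\<zeta> \<cdot> (h \<lhd> A)) \<cdot> m = (\<zeta> \<cdot> (Z \<rhd> m)) \<cdot> (h \<lhd> (A \<odot> A))"
    using 1 ty by (simp add: mon)
  also have "\<dots> = act A m Z \<zeta> \<cdot> ((\<zeta> \<cdot> (h \<lhd> A)) \<lhd> A)"
    unfolding z(6) act_def using ty by (simp add: mon)
  finally show ?thesis using ty by (simp add: mon hom_def)
qed

lemma generator_eq:
  assumes "left_tensor_generator C \<one>" "f \<in> hom C (Y \<odot> Z) W" "g \<in> hom C (Y \<odot> Z) W"
    "Y \<in> Ob C" "Z \<in> Ob C" "\<And>h. h \<in> hom C \<one> Y \<Longrightarrow> f \<cdot> (h \<lhd> Z) = g \<cdot> (h \<lhd> Z)"
  shows "f = g"
  using assms hom_Ob(2)[OF assms(2)] unfolding left_tensor_generator_def by blast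

text \<open>A Yoneda argument: testing naturality on the linear maps \<open>A \<rightarrow> A\<close> and \<open>A \<rightarrow> AZ\<close> that
  come from points of \<open>A\<close> and \<open>Z\<close>, and using that points separate morphisms.\<close>

lemma natural_eq_act:
  assumes gen: "left_tensor_generator C \<one>" and Z: "transfer Z \<zeta>" and U: "U \<in> Ob C" and V: "V \<in> Ob C"
    and \<sigma>: "\<And>N \<mu>. module N \<mu> \<Longrightarrow> \<sigma> N \<mu> \<in> hom C (N \<odot> U) (N \<odot> V)"
    and nat: "\<And>N \<mu> N' \<mu>' h. module N \<mu> \<Longrightarrow> module N' \<mu>' \<Longrightarrow> linear N \<mu> N' \<mu>' h \<Longrightarrow>
      \<sigma> N' \<mu>' \<cdot> (h \<lhd> U) = (h \<lhd> V) \<cdot> \<sigma> N \<mu>"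
  shows "\<sigma> (A \<odot> Z) (act A m Z \<zeta>) = act (A \<odot> Z) (act A m Z \<zeta>) V (\<sigma> A m \<cdot> (\<eta> \<lhd> U))"
proof -
  note z = transfer[OF Z] and MZ = act_module[OF module_A Z]
  define s where "s = \<sigma> (A \<odot> Z) (act A m Z \<zeta>)"
  have sh: "s \<in> hom C (A \<odot> Z \<odot> U) (A \<odot> Z \<odot> V)"
    using \<sigma>[OF MZ] A z(1) U V by (simp add: tensor_assoc_Ob s_def)
  note ty = A z(1,3-5) U V \<sigma>[OF module_A, unfolded hom_def] sh[unfolded hom_def]
  have e: "\<eta> \<in> hom C \<one> A" using A by (simp add: hom_def)
  \<comment> \<open>Left \<open>A\<close>-linearity of \<open>s\<close>: naturality gives it for
    multiplication by each point of \<open>A\<close>, and the generator property removes the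
    point.\<close>
  have 1: "s \<cdot> (m \<lhd> (Z \<odot> U)) = (m \<lhd> (Z \<odot> V)) \<cdot> (A \<rhd> s)"
  proof (rule generator_eq[OF gen, where Y = A and Z = "A \<odot> Z \<odot> U"])
    fix h assume h: "h \<in> hom C \<one> A"
    note ty = ty h[unfolded hom_def]
    have "s \<cdot> ((m \<cdot> (h \<lhd> A)) \<lhd> Z) \<lhd> U = ((m \<cdot> (h \<lhd> A)) \<lhd> Z) \<lhd> V \<cdot> s"
      unfolding s_def
      by (rule nat[OF MZ MZ linear_whisker[OF module_A module_A linear_left_mult[OF h] Z]])
    then have "(s \<cdot> (m \<lhd> (Z \<odot> U))) \<cdot> (h \<lhd> (A \<odot> Z \<odot> U)) = (m \<lhd> (Z \<odot> V)) \<cdot> ((h \<lhd> (A \<odot> Z \<odot> V)) \<cdot> s)"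
      using ty by (simp add: mon)
    also have "(h \<lhd> (A \<odot> Z \<odot> V)) \<cdot> s = (A \<rhd> s) \<cdot> (h \<lhd> (A \<odot> Z \<odot> U))"
      using exchange[OF h sh] ty by (simp add: mon)
    finally show "(s \<cdot> (m \<lhd> (Z \<odot> U))) \<cdot> (h \<lhd> (A \<odot> Z \<odot> U)) =
        ((m \<lhd> (Z \<odot> V)) \<cdot> (A \<rhd> s)) \<cdot> (h \<lhd> (A \<odot> Z \<odot> U))"
      using ty by (simp add: mon)
  qed (use ty in \<open>auto simp: hom_def mon\<close>)
  \<comment> \<open>In the same way, points of \<open>Z\<close> tie \<open>s\<close> to the
    component at \<open>A\<close> through \<open>\<zeta>\<close>.\<close>
  have 2: "s \<cdot> (\<zeta> \<lhd> U) = (\<zeta> \<lhd> V) \<cdot> (Z \<rhd> \<sigma> A m)"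
  proof (rule generator_eq[OF gen, where Y = Z and Z = "A \<odot> U"])
    fix h assume h: "h \<in> hom C \<one> Z"
    note ty = ty h[unfolded hom_def]
    have "s \<cdot> (\<zeta> \<cdot> (h \<lhd> A)) \<lhd> U = (\<zeta> \<cdot> (h \<lhd> A)) \<lhd> V \<cdot> \<sigma> A m"
      unfolding s_def by (rule nat[OF module_A MZ linear_transfer[OF Z h]])
    then have "(s \<cdot> (\<zeta> \<lhd> U)) \<cdot> (h \<lhd> (A \<odot> U)) = (\<zeta> \<lhd> V) \<cdot> ((h \<lhd> (A \<odot> V)) \<cdot> \<sigma> A m)"
      using ty by (simp add: mon)
    also have "(h \<lhd> (A \<odot> V)) \<cdot> \<sigma> A m = (Z \<rhd> \<sigma> A m) \<cdot> (h \<lhd> (A \<odot> U))"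
      using exchange[OF h \<sigma>[OF module_A]] ty by (simp add: mon)
    finally show "(s \<cdot> (\<zeta> \<lhd> U)) \<cdot> (h \<lhd> (A \<odot> U)) = ((\<zeta> \<lhd> V) \<cdot> (Z \<rhd> \<sigma> A m)) \<cdot> (h \<lhd> (A \<odot> U))"
      using ty by (simp add: mon)
  qed (use ty in \<open>auto simp: hom_def mon\<close>)
  have 3: "\<eta> \<lhd> (Z \<odot> U) = (\<zeta> \<lhd> U) \<cdot> (Z \<rhd> \<eta> \<lhd> U)"
    using arg_cong[OF z(7), of "\<lambda>x. x \<lhd> U"] ty by (simp add: mon)
  have 4: "(m \<lhd> (Z \<odot> U)) \<cdot> (A \<rhd> \<eta> \<lhd> (Z \<odot> U)) = Id C (A \<odot> Z \<odot> U)"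
    using arg_cong[OF m_unit(2), of "\<lambda>x. x \<lhd> (Z \<odot> U)"] ty by (simp add: mon)
  define f where "f = \<sigma> A m \<cdot> (\<eta> \<lhd> U)"
  have f: "f \<in> hom C U (A \<odot> V)"
    unfolding f_def using ty by (simp add: mon hom_def)
  note ty = ty f[unfolded hom_def]
  \<comment> \<open>The unit axiom of \<open>\<zeta>\<close> makes the second relation applicable,
    so \<open>s\<close> restricted along \<open>\<eta>\<close> is expressed by
    \<open>f\<close>.\<close>
  have "s \<cdot> (\<eta> \<lhd> (Z \<odot> U)) = (s \<cdot> (\<zeta> \<lhd> U)) \<cdot> (Z \<rhd> \<eta> \<lhd> U)"
    unfolding 3 using ty by (simp add: mon)
  also have "\<dots> = (\<zeta> \<lhd> V) \<cdot> (Z \<rhd> f)"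
    unfolding 2 f_def using ty by (simp add: mon)
  finally have 5: "s \<cdot> (\<eta> \<lhd> (Z \<odot> U)) = (\<zeta> \<lhd> V) \<cdot> (Z \<rhd> f)" .
  \<comment> \<open>Being left \<open>A\<close>-linear, \<open>s\<close> is determined by that
    restriction.\<close>
  have "s = s \<cdot> ((m \<lhd> (Z \<odot> U)) \<cdot> (A \<rhd> \<eta> \<lhd> (Z \<odot> U)))"
    unfolding 4 using ty by (simp add: mon)
  also have "\<dots> = (s \<cdot> (m \<lhd> (Z \<odot> U))) \<cdot> (A \<rhd> \<eta> \<lhd> (Z \<odot> U))"
    using ty by (simp add: mon)
  also have "\<dots> = (m \<lhd> (Z \<odot> V)) \<cdot> (A \<rhd> (s \<cdot> (\<eta> \<lhd> (Z \<odot> U))))"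
    unfolding 1 using ty by (simp add: mon)
  also have "\<dots> = act (A \<odot> Z) (act A m Z \<zeta>) V f"
    unfolding 5 using act_tensor[OF module_A f V z(1,2)] by (simp add: act_def[of A m "Z \<odot> V"])
  finally show ?thesis unfolding s_def f_def .
qed

text \<open>The case where \<open>Z\<close> is the unit object of the transfer category.\<close>

lemma natural_eq_act_A:
  assumes gen: "left_tensor_generator C \<one>" and U: "U \<in> Ob C" and V: "V \<in> Ob C"
    and \<sigma>: "\<And>N \<mu>. module N \<mu> \<Longrightarrow> \<sigma> N \<mu> \<in> hom C (N \<odot> U) (N \<odot> V)"
    and nat: "\<And>N \<mu> N' \<mu>' h. module N \<mu> \<Longrightarrow> module N' \<mu>' \<Longrightarrow> linear N \<mu> N' \<mu>' h \<Longrightarrow>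
      \<sigma> N' \<mu>' \<cdot> (h \<lhd> U) = (h \<lhd> V) \<cdot> \<sigma> N \<mu>"
  shows "\<sigma> A m = act A m V (\<sigma> A m \<cdot> (\<eta> \<lhd> U))"
  using natural_eq_act[where \<sigma> = \<sigma>, OF gen transfer_unit U V \<sigma> nat] act_module_one[OF module_A] A
  by (simp add: unit_right_Ob)

end

section \<open>Frobenius data from the unit and counit of the second adjunction\<close>

context transfer_coalgebra
begin

lemma frobenius_data_if_left_adjoint:
  assumes gen: "left_tensor_generator C \<one>"
    and adj: "left_adjoint D E cofree_ob cofree_ar forgetful_ob forgetful_ar"
  shows "\<exists>t B. frobenius_data t B"
proof -
  obtain u c where u: "\<And>P. P \<in> Ob D \<Longrightarrow> u P \<in> hom D P (forgetful_ob (cofree_ob P))"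
      "\<And>P Q f. f \<in> hom D P Q \<Longrightarrow> u Q \<cdot>\<^bsub>D\<^esub> f = forgetful_ar (cofree_ar f) \<cdot>\<^bsub>D\<^esub> u P"
    and c: "\<And>P. P \<in> Ob E \<Longrightarrow> c P \<in> hom E (cofree_ob (forgetful_ob P)) P"
      "\<And>P Q f. f \<in> hom E P Q \<Longrightarrow> c Q \<cdot>\<^bsub>E\<^esub> cofree_ar (forgetful_ar f) = f \<cdot>\<^bsub>E\<^esub> c P"
    and tri: "\<And>P. P \<in> Ob D \<Longrightarrow> c (cofree_ob P) \<cdot>\<^bsub>E\<^esub> cofree_ar (u P) = Id E (cofree_ob P)"
      "\<And>P. P \<in> Ob E \<Longrightarrow> forgetful_ar (c P) \<cdot>\<^bsub>D\<^esub> u (forgetful_ob P) = Id D (forgetful_ob P)"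
    by (rule left_adjointE[OF adj]) (rule that; assumption)
  \<comment> \<open>Arrows of \<open>D\<close> and \<open>E\<close> are triples; \<open>u0\<close>
    and \<open>k\<close> are the underlying morphisms in \<open>C\<close>. The counit is needed only
    at cofree modules, and composing it there with the action of \<open>\<epsilon>\<close> gives a
    family \<open>\<tau>\<close> indexed by modules.\<close>
  define u0 where "u0 N \<mu> = snd (snd (u (N, \<mu>)))" for N \<mu>
  define k where "k N \<mu> = snd (snd (c (cofree_ob (N, \<mu>))))" for N \<mu>
  define \<tau> where "\<tau> N \<mu> = act N \<mu> \<one> \<epsilon> \<cdot> k N \<mu>" for N \<mu>
  let ?\<delta> = "\<lambda>N \<mu>. act N \<mu> (X \<odot> X) \<delta>" and ?\<psi> = "\<lambda>N \<mu>. act N \<mu> X \<psi>"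
  have u_eq: "u (N, \<mu>) = ((N, \<mu>), (N \<odot> X, ?\<psi> N \<mu>), u0 N \<mu>)"
    and u_lin: "linear N \<mu> (N \<odot> X) (?\<psi> N \<mu>) (u0 N \<mu>)" if "module N \<mu>" for N \<mu>
    using u(1)[of "(N, \<mu>)"] that by (auto simp: Ob_D hom_D cofree_simps u0_def)
  have c_eq: "c (cofree_ob (N, \<mu>)) = (cofree_ob (N \<odot> X, ?\<psi> N \<mu>), cofree_ob (N, \<mu>), k N \<mu>)"
    and k_bil: "entwined_map (N \<odot> X \<odot> X) (?\<psi> (N \<odot> X) (?\<psi> N \<mu>)) (?\<delta> (N \<odot> X) (?\<psi> N \<mu>))
        (N \<odot> X) (?\<psi> N \<mu>) (?\<delta> N \<mu>) (k N \<mu>)" if "module N \<mu>" for N \<mu>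
    using c(1)[of "cofree_ob (N, \<mu>)"] entwined_cofree[OF that] module(1)[OF that] X(1)
    by (auto simp: Ob_E hom_E cofree_simps k_def tensor_assoc_Ob)
  have u_nat: "u0 N' \<mu>' \<cdot> h = (h \<lhd> X) \<cdot> u0 N \<mu>"
    if "module N \<mu>" "module N' \<mu>'" "linear N \<mu> N' \<mu>' h" for N \<mu> N' \<mu>' h
    using u(2)[of "((N, \<mu>), (N', \<mu>'), h)" "(N, \<mu>)" "(N', \<mu>')"] that
    by (simp add: hom_D u_eq comp_D cofree_simps)
  \<comment> \<open>Here \<open>h\<close> may be any entwined map between cofree modules, not only
    one of the form \<open>g \<lhd> X\<close>; \<open>k_right\<close> applies this to a
    coaction.\<close>
  have c_nat: "k N' \<mu>' \<cdot> (h \<lhd> X) = h \<cdot> k N \<mu>"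
    if N: "module N \<mu>" "module N' \<mu>'" and
      h: "entwined_map (N \<odot> X) (?\<psi> N \<mu>) (?\<delta> N \<mu>) (N' \<odot> X) (?\<psi> N' \<mu>') (?\<delta> N' \<mu>') h" for N \<mu> N' \<mu>' h
  proof -
    have "(cofree_ob (N, \<mu>), cofree_ob (N', \<mu>'), h) \<in> hom E (cofree_ob (N, \<mu>)) (cofree_ob (N', \<mu>'))"
      using h entwined_cofree[OF N(1)] entwined_cofree[OF N(2)] by (simp add: cofree_simps hom_E)
    from c(2)[OF this] show ?thesis
      using c_eq[OF N(1)] c_eq[OF N(2)] by (simp add: cofree_simps comp_E)
  qed
  have tri1: "k N \<mu> \<cdot> (u0 N \<mu> \<lhd> X) = Id C (N \<odot> X)" if "module N \<mu>" for N \<mu>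
    using tri(1)[of "(N, \<mu>)"] that by (simp add: Ob_D u_eq c_eq) (simp add: comp_E id_E cofree_simps)
  have tri2: "k N \<mu> \<cdot> u0 (N \<odot> X) (?\<psi> N \<mu>) = Id C (N \<odot> X)" if N: "module N \<mu>" for N \<mu>
  proof -
    have "cofree_ob (N, \<mu>) \<in> Ob E" using entwined_cofree[OF N] by (simp add: cofree_simps Ob_E)
    from tri(2)[OF this] show ?thesis
      unfolding c_eq[OF N] by (simp add: cofree_simps u_eq act_module[OF N trX] comp_D id_D)
  qed
  note k_hom = conjunct1[OF conjunct1[OF k_bil]]
  have \<tau>_hom: "\<tau> N \<mu> \<in> hom C (N \<odot> X \<odot> X) N" if "module N \<mu>" for N \<mu>
    unfolding \<tau>_def by (rule comp_in_hom[OF k_hom act_\<epsilon>_hom]) (rule that)+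
  have typed0: "k N \<mu> \<in> Ar C" "Dom C (k N \<mu>) = N \<odot> X \<odot> X" "Cod C (k N \<mu>) = N \<odot> X"
    "u0 N \<mu> \<in> Ar C" "Dom C (u0 N \<mu>) = N" "Cod C (u0 N \<mu>) = N \<odot> X"
    "act N \<mu> \<one> \<epsilon> \<in> Ar C" "Dom C (act N \<mu> \<one> \<epsilon>) = N \<odot> X" "Cod C (act N \<mu> \<one> \<epsilon>) = N"
    "?\<delta> N \<mu> \<in> Ar C" "Dom C (?\<delta> N \<mu>) = N \<odot> X" "Cod C (?\<delta> N \<mu>) = N \<odot> X \<odot> X"
    "N \<in> Ob C" "X \<in> Ob C" if "module N \<mu>" for N \<mu>
    using k_hom[OF that] u_lin[OF that] act_\<epsilon>_hom[OF that] act_\<delta>_hom[OF that] module(1)[OF that] X(1)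
    by (simp_all add: hom_def)
  have \<tau>_nat: "\<tau> N' \<mu>' \<cdot> (h \<lhd> (X \<odot> X)) = h \<cdot> \<tau> N \<mu>"
    if N: "module N \<mu>" "module N' \<mu>'" and h: "linear N \<mu> N' \<mu>' h" for N \<mu> N' \<mu>' h
  proof -
    have h': "h \<in> Ar C" "Dom C h = N" "Cod C h = N'" using h by (auto simp: hom_def)
    note ty = typed0[OF N(1)] typed0[OF N(2)] h'
    have 1: "k N' \<mu>' \<cdot> (h \<lhd> (X \<odot> X)) = (h \<lhd> X) \<cdot> k N \<mu>"
      using c_nat[OF N entwined_map_cofree[OF N h]] ty by (simp add: mon)
    have 2: "h \<cdot> act N \<mu> \<one> \<epsilon> = act N' \<mu>' \<one> \<epsilon> \<cdot> (h \<lhd> X)"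
      using act_natural[OF N h \<epsilon>_hom unit_in_Ob] ty by (simp add: mon)
    have "\<tau> N' \<mu>' \<cdot> (h \<lhd> (X \<odot> X)) = (act N' \<mu>' \<one> \<epsilon> \<cdot> (h \<lhd> X)) \<cdot> k N \<mu>"
      unfolding \<tau>_def using 1 ty by (simp add: mon)
    also have "\<dots> = h \<cdot> \<tau> N \<mu>"
      unfolding 2[symmetric] \<tau>_def using ty by (simp add: mon)
    finally show ?thesis .
  qed
  \<comment> \<open>These are the morphisms that \<open>natural_eq_act\<close> associates with the
    families \<open>u0\<close> and \<open>\<tau>\<close>: the component at \<open>A\<close>,
    restricted along \<open>\<eta>\<close>.\<close>
  define t where "t = u0 A m \<cdot> \<eta>"
  define B where "B = \<tau> A m \<cdot> (\<eta> \<lhd> (X \<odot> X))"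
  note MA = module_A and MX = act_module[OF module_A trX]
  note TA = typed0[OF MA] and TX = typed0[OF MX]
  \<comment> \<open>The representation lemmas expect families from \<open>NU\<close> to
    \<open>NV\<close>, so a bare \<open>N\<close> is written as \<open>N \<odot> \<one>\<close> here
    and for \<open>u0\<close> below.\<close>
  have \<tau>_hom': "\<tau> N \<mu> \<in> hom C (N \<odot> X \<odot> X) (N \<odot> \<one>)" if "module N \<mu>" for N \<mu>
    using \<tau>_hom[OF that] module(1)[OF that] by (simp add: unit_right_Ob)
  have \<tau>_nat': "\<tau> N' \<mu>' \<cdot> (h \<lhd> (X \<odot> X)) = (h \<lhd> \<one>) \<cdot> \<tau> N \<mu>"
    if "module N \<mu>" "module N' \<mu>'" "linear N \<mu> N' \<mu>' h" for N \<mu> N' \<mu>' h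
    using \<tau>_nat[OF that] that(3) by (simp add: hom_def whisker_unit)
  have u_hom': "u0 N \<mu> \<in> hom C (N \<odot> \<one>) (N \<odot> X)" if "module N \<mu>" for N \<mu>
    using u_lin[OF that] module(1)[OF that] by (simp add: unit_right_Ob)
  have u_nat': "u0 N' \<mu>' \<cdot> (h \<lhd> \<one>) = (h \<lhd> X) \<cdot> u0 N \<mu>"
    if "module N \<mu>" "module N' \<mu>'" "linear N \<mu> N' \<mu>' h" for N \<mu> N' \<mu>' h
    using u_nat[OF that] that(3) by (simp add: hom_def whisker_unit)
  have \<tau>A: "\<tau> A m = act A m \<one> B"
    unfolding B_def by (rule natural_eq_act_A[OF gen XX(1) unit_in_Ob \<tau>_hom' \<tau>_nat'])
  have \<tau>X: "\<tau> (A \<odot> X) (?\<psi> A m) = act (A \<odot> X) (?\<psi> A m) \<one> B"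
    unfolding B_def by (rule natural_eq_act[OF gen trX XX(1) unit_in_Ob \<tau>_hom' \<tau>_nat'])
  have uA: "u0 A m = act A m X t"
    using natural_eq_act_A[where \<sigma> = u0, OF gen unit_in_Ob X(1) u_hom' u_nat'] A by (simp add: t_def whisker_unit)
  have uX: "u0 (A \<odot> X) (?\<psi> A m) = act (A \<odot> X) (?\<psi> A m) X t"
    using natural_eq_act[where \<sigma> = u0, OF gen trX unit_in_Ob X(1) u_hom' u_nat'] A by (simp add: t_def whisker_unit)
  have th: "t \<in> hom C \<one> (A \<odot> X)" unfolding t_def using TA A by (simp add: mon hom_def)
  have Bh: "B \<in> hom C (X \<odot> X) (A \<odot> \<one>)"
    unfolding B_def using \<tau>_hom[OF MA] TA A by (simp add: mon hom_def)
  have t_mor: "transfer_mor \<one> (Id C A) X \<psi> t"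
    using u_lin[OF MA] act_module_one[OF MA] A
    by (intro transfer_mor_if_linear[OF transfer_unit trX th]) (simp add: uA unit_right_Ob)
  have "linear (A \<odot> X \<odot> X) (?\<psi> (A \<odot> X) (?\<psi> A m)) A m (\<tau> A m)"
    unfolding \<tau>_def
    using linear_comp[OF conjunct1[OF k_bil[OF MA]] linear_counit[OF MA] _ MX MA]
      act_module[OF MX trX] TA A by (simp add: tensor_assoc_Ob)
  then have B_mor: "transfer_mor (X \<odot> X) \<psi>\<^sub>2 \<one> (Id C A) B"
    using act_module_one[OF MA] act_module_tensor[OF MA trX trX] A
    by (intro transfer_mor_if_linear[OF trXX transfer_unit Bh]) (simp add: \<tau>A unit_right_Ob \<psi>\<^sub>2_def)
  note ty = TA TX A act_module[OF MA trX]
  \<comment> \<open>Colinearity of \<open>k A m\<close> moves it in front of the coaction, where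
    \<open>\<epsilon>\<close> cancels \<open>\<delta>\<close> by the left counit law.\<close>
  have k_left: "(\<tau> A m \<lhd> X) \<cdot> ?\<delta> (A \<odot> X) (?\<psi> A m) = k A m"
  proof -
    have "(\<tau> A m \<lhd> X) \<cdot> ?\<delta> (A \<odot> X) (?\<psi> A m) =
        (act A m \<one> \<epsilon> \<lhd> X) \<cdot> ((k A m \<lhd> X) \<cdot> ?\<delta> (A \<odot> X) (?\<psi> A m))"
      unfolding \<tau>_def using ty by (simp add: mon)
    also have "\<dots> = ((act A m \<one> \<epsilon> \<lhd> X) \<cdot> ?\<delta> A m) \<cdot> k A m"
      unfolding conjunct2[OF k_bil[OF MA]] using ty by (simp add: mon)
    finally show ?thesis
      unfolding act_counit_left[OF MA] using ty by (simp add: mon)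
  qed
  \<comment> \<open>Linearity and coassociativity say that the coaction of the cofree module on
    \<open>A\<close> is an entwined map into the cofree module on \<open>AX\<close>. Naturality of
    the counit along it, followed by the right counit law, gives the second expression for
    \<open>k A m\<close>.\<close>
  have k_right: "\<tau> (A \<odot> X) (?\<psi> A m) \<cdot> (?\<delta> A m \<lhd> X) = k A m"
  proof -
    have "entwined_map (A \<odot> X) (?\<psi> A m) (?\<delta> A m) ((A \<odot> X) \<odot> X) (?\<psi> (A \<odot> X) (?\<psi> A m))
        (?\<delta> (A \<odot> X) (?\<psi> A m)) (?\<delta> A m)"
      using entwinedD(2,3)[OF entwined_cofree[OF MA]] by simp
    from c_nat[OF MA MX this]
    have 1: "k (A \<odot> X) (?\<psi> A m) \<cdot> (?\<delta> A m \<lhd> X) = ?\<delta> A m \<cdot> k A m" .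
    have "\<tau> (A \<odot> X) (?\<psi> A m) \<cdot> (?\<delta> A m \<lhd> X) =
        act (A \<odot> X) (?\<psi> A m) \<one> \<epsilon> \<cdot> (k (A \<odot> X) (?\<psi> A m) \<cdot> (?\<delta> A m \<lhd> X))"
      unfolding \<tau>_def using ty by (simp add: mon)
    also have "\<dots> = (act (A \<odot> X) (?\<psi> A m) \<one> \<epsilon> \<cdot> ?\<delta> A m) \<cdot> k A m"
      unfolding 1 using ty by (simp add: mon)
    finally show ?thesis
      unfolding act_counit_right[OF MA] using ty by (simp add: mon)
  qed
  note t' = th[unfolded hom_def] and B' = Bh[unfolded hom_def] and \<delta>' = \<delta>_hom[unfolded hom_def]
    and \<epsilon>' = \<epsilon>_hom[unfolded hom_def]
  have "frobenius_data t B"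
    unfolding frobenius_data_def
  proof (intro conjI t_mor B_mor)
    \<comment> \<open>By faithfulness it suffices to compare the actions on \<open>A\<close>, and
      both of them equal \<open>k A m\<close>.\<close>
    show "(m \<lhd> X) \<cdot> (A \<rhd> (\<psi> \<cdot> (X \<rhd> B))) \<cdot> (\<delta> \<lhd> X) =
       (m \<lhd> X) \<cdot> (A \<rhd> (B \<lhd> X)) \<cdot> ((\<psi> \<lhd> (X \<odot> X)) \<cdot> (X \<rhd> \<delta>))"
    proof (rule act_A_inject[where U = "X \<odot> X" and V = X])
      show "act A m X ((m \<lhd> X) \<cdot> (A \<rhd> (\<psi> \<cdot> (X \<rhd> B))) \<cdot> (\<delta> \<lhd> X)) =
        act A m X ((m \<lhd> X) \<cdot> (A \<rhd> (B \<lhd> X)) \<cdot> ((\<psi> \<lhd> (X \<odot> X)) \<cdot> (X \<rhd> \<delta>)))"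
        unfolding act_frobenius_left[OF th Bh MA] act_frobenius_right[OF th Bh MA]
        using k_left k_right by (simp add: \<tau>A \<tau>X)
    qed (use X A B' \<delta>' in \<open>auto simp: hom_def mon\<close>)
    \<comment> \<open>On \<open>A\<close> this is the triangle identity \<open>tri1\<close>,
      followed by the action of \<open>\<epsilon>\<close>.\<close>
    show "(m \<lhd> \<one>) \<cdot> (A \<rhd> B) \<cdot> (t \<lhd> X) = \<epsilon>"
    proof (rule act_A_inject[where U = X and V = \<one>])
      have "\<tau> A m \<cdot> (u0 A m \<lhd> X) = act A m \<one> \<epsilon> \<cdot> (k A m \<cdot> (u0 A m \<lhd> X))"
        unfolding \<tau>_def using ty by (simp add: mon)
      then show "act A m \<one> ((m \<lhd> \<one>) \<cdot> (A \<rhd> B) \<cdot> (t \<lhd> X)) = act A m \<one> \<epsilon>"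
        unfolding tri1[OF MA] unfolding act_unit_left[OF th Bh MA] \<tau>A uA using ty by (simp add: mon)
    qed (use X A B' t' \<epsilon>' in \<open>auto simp: hom_def mon\<close>)
    \<comment> \<open>On \<open>A\<close> this is \<open>tri2\<close>, the triangle identity at the
      cofree module on \<open>A\<close>; it involves the unit at \<open>AX\<close>, hence the
      representation \<open>uX\<close>.\<close>
    show "(m \<lhd> \<one>) \<cdot> (A \<rhd> B) \<cdot> ((\<psi> \<lhd> X) \<cdot> (X \<rhd> t)) = \<epsilon>"
    proof (rule act_A_inject[where U = X and V = \<one>])
      have "\<tau> A m \<cdot> u0 (A \<odot> X) (?\<psi> A m) = act A m \<one> \<epsilon> \<cdot> (k A m \<cdot> u0 (A \<odot> X) (?\<psi> A m))"
        unfolding \<tau>_def using ty by (simp add: mon)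
      then show "act A m \<one> ((m \<lhd> \<one>) \<cdot> (A \<rhd> B) \<cdot> ((\<psi> \<lhd> X) \<cdot> (X \<rhd> t))) = act A m \<one> \<epsilon>"
        unfolding tri2[OF MA] unfolding act_unit_right[OF th Bh MA] \<tau>A uX using ty by (simp add: mon)
    qed (use X A B' t' \<epsilon>' in \<open>auto simp: hom_def mon\<close>)
  qed
  then show ?thesis by blast
qed

end

theorem theorem4p8:
  fixes C :: "('o, 'm) monoidal_category"
    and A X :: "'o" and m \<eta> \<psi> \<delta> \<epsilon> :: "'m"
  assumes "strict_monoidal_category C"
    and "cowreath C A m \<eta> X \<psi> \<delta> \<epsilon>"
    and "left_tensor_generator C (Unit C)"
  shows "frobenius_functor (entwined_modules C A m \<eta> X \<psi> \<delta> \<epsilon>) (right_modules C A m \<eta>)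
           forgetful_ob forgetful_ar
         \<longleftrightarrow> frobenius_coalgebra (transfer_category C A m \<eta>) (X, \<psi>)
           (transfer_comult C A m \<eta> X \<psi> \<delta>) (transfer_counit C A m \<eta> X \<psi> \<epsilon>)"
proof -
  interpret strict_monoidal_category C by (rule assms(1))
  interpret transfer_coalgebra C A m \<eta> X \<psi> \<delta> \<epsilon>
    using assms(2) by unfold_locales (auto simp: cowreath_def)
  show ?thesis
    using frobenius_functor_iff frobenius_iff cofree_left_adjoint
      frobenius_data_if_left_adjoint[OF assms(3)] by blast
qed

end
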